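(* Let $w$ be a weight function. Assume that $\mathcal{R}(a_k, \lambda h) \neq \emptyset$ for some $0 < \lambda < 1$. Then for each $f \in C^2(\overline{\Omega}_H)$, $$| \nabla f(a_k) - \widetilde{\nabla}_h f(a_k) | \leq 4 h | f |_{C^2} + \left\{ \frac{8 r_\sigma}{\lambda h} + 4 c_1(a_k) + 4 c_2(a_k) + 8 c_3(a_k) \right\} | f |_{C^1},$$ where $$c_1(a_k) := \frac{ \| w(a_k - \cdot) \|_{L^1(\sigma_k \setminus B_\delta(a_k))} }{ \| w(a_k - \cdot) \|_{L^1(B_h(a_k) \setminus B_\delta(a_k))} }, \qquad c_2(a_k) := \frac{ \pi L_w r_\sigma h^2 }{ \| w(a_k - \cdot) \|_{L^1(B_h(a_k) \setminus \sigma_k)} },$$ $$c_3(a_k) := \frac{ \| w(a_k - \cdot) \|_{L^1(B_{\lambda h + r_\sigma}(a_k) \setminus \sigma_k)} }{ \| w(a_k - \cdot) \|_{L^1(B_h(a_k) \setminus \sigma_k)} }.$$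
   Context: Setting. $B_r(x) = \{ y \in \mathbb{R}^2 : |x-y| < r \}$, $B_{r,\ell}(x) = \{ y \in \mathbb{R}^2 : \ell < |y-x| < r \}$, $B_r = B_r(0)$, $B_{r,\ell} = B_{r,\ell}(0)$. Fix a bounded domain $\Omega \subset \mathbb{R}^2$ and $H>0$, and let $\Omega_H = \{ x \in \mathbb{R}^2 : |x-y| < H \text{ for some } y \in \Omega \}$. Let $N \in \mathbb{N}$ and let $a_1, \dots, a_N \in \Omega_H$ be pairwise distinct. For each $i$ let $\sigma_i = \{ x \in \Omega_H : |x-a_i| < |x-a_j| \text{ for all } j \neq i \}$ (Voronoi cell), and let $r_\sigma = \max_{1\le i\le N} \max_{y \in \overline{\sigma}_i} |y-a_i|$. Assume $r_\sigma < H$. Fix $h$ (the influence radius) with $r_\sigma < h < H$, fix $k \in \{1,\dots,N\}$ with $a_k \in \sigma_k \cap \Omega$, and fix $\delta>0$ with $B_\delta(a_k) \subset \sigma_k \cap \Omega$. Assume $B_{h+r_\sigma}(x) \subset \Omega_H$ for each $x \in B_\delta(a_k)$. For $x \in B_\delta(a_k)$ and $\rho>0$ let $\mathcal{R}(x,\rho) = \{ i : 0 \le |x-a_i| < \rho \} \setminus \{k\}$, and let $V_i(x) = \int_{\sigma_i \cap B_{h,\delta}(x)} 1 \, dy$. Norms. $|f|_{C^0} = \max_{\overline{\Omega}_H} |f|$, $|f|_{C^j} = \max_{|\alpha|=j} |D^\alpha f|_{C^0}$; $\|g\|_{L^1(U)} = \int_U |g(y)|\,dy$; $w(a_k-\cdot)$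 denotes $y \mapsto w(a_k-y)$. Weight function. A function $w \in L^\infty(\mathbb{R}^2) \cap C(\overline{B}_{h,\delta})$ is a weight function if: (i) $w(x) \ge 0$ for almost all $x \in \mathbb{R}^2$; (ii) $w(x)=0$ for almost all $x \in \mathbb{R}^2 \setminus \overline{B}_{h,\delta}$; (iii) there is $L_w \ge 0$ with $|w(x)-w(y)| \le L_w|x-y|$ for all $x,y \in B_{h,\delta}$ (this $L_w$ is the constant used below); (iv) there is $\widehat{w} \in L^1(\delta,h)$ with $w(x) = \widehat{w}(|x|)$ for almost all $x \in B_{h,\delta}$; (v) there is $C_0>0$ such that for each $x \in B_\delta(a_k)$, $\sum_{i \in \mathcal{R}(x,h)} \int_{\sigma_i} w(x-y)\,dy \ge C_0$ and $\sum_{j \in \mathcal{R}(x,h)} V_j(x) w(x-a_j) \ge C_0$. Operator. For $f \in C(\overline{\Omega}_H)$, $$\widetilde{\nabla}_h f(a_k) = 2\, \frac{ \sum_{i \in \mathcal{R}(a_k,h)} V_i(a_k) \frac{f(a_k)-f(a_i)}{|a_k-a_i|} \frac{a_k-a_i}{|a_k-a_i|} w(a_k-a_i) }{ \sum_{j \in \mathcal{R}(a_k,h)} V_j(a_k) w(a_k-a_j) }.$$ *)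

theory Defs
  imports "HOL-Analysis.Analysis"
begin

definition annulus :: "real \<Rightarrow> real \<Rightarrow> real^2 \<Rightarrow> (real^2) set" where
  "annulus r l x = {y. l < norm (y - x) \<and> norm (y - x) < r}"

definition nbhd :: "(real^2) set \<Rightarrow> real \<Rightarrow> (real^2) set" where
  "nbhd \<Omega> H = {x. \<exists>y\<in>\<Omega>. norm (x - y) < H}"

text \<open>The particles are \<open>a 1, \<dots>, a N\<close>; values of \<open>a\<close> at other indices play no role.\<close>

definition voronoi :: "(real^2) set \<Rightarrow> real \<Rightarrow> nat \<Rightarrow> (nat \<Rightarrow> real^2) \<Rightarrow> nat \<Rightarrow> (real^2) set" where
  "voronoi \<Omega> H N a i =
     {x \<in> nbhd \<Omega> H. \<forall>j\<in>{1..N}. j \<noteq> i \<longrightarrow> norm (x - a i) < norm (x - a j)}"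

text \<open>The inner supremum is a maximum: in the setting of interest the closure of a cell is
  compact, and it is nonempty because it contains \<open>a i\<close>.\<close>

definition r_sigma :: "(real^2) set \<Rightarrow> real \<Rightarrow> nat \<Rightarrow> (nat \<Rightarrow> real^2) \<Rightarrow> real" where
  "r_sigma \<Omega> H N a =
     Max ((\<lambda>i. SUP y\<in>closure (voronoi \<Omega> H N a i). norm (y - a i)) ` {1..N})"

definition neighbours :: "nat \<Rightarrow> (nat \<Rightarrow> real^2) \<Rightarrow> nat \<Rightarrow> real^2 \<Rightarrow> real \<Rightarrow> nat set" where
  "neighbours N a k x \<rho> = {i\<in>{1..N}. 0 \<le> norm (x - a i) \<and> norm (x - a i) < \<rho>} - {k}"

definition cell_vol ::
  "(real^2) set \<Rightarrow> real \<Rightarrow> nat \<Rightarrow> (nat \<Rightarrow> real^2) \<Rightarrow> real \<Rightarrow> real \<Rightarrow> nat \<Rightarrow> real^2 \<Rightarrow> real" where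
  "cell_vol \<Omega> H N a h \<delta> i x = (LINT y:voronoi \<Omega> H N a i \<inter> annulus h \<delta> x|lebesgue. 1)"

definition L1_norm_on :: "(real^2) set \<Rightarrow> (real^2 \<Rightarrow> real) \<Rightarrow> real" where
  "L1_norm_on U g = (LINT y:U|lebesgue. \<bar>g y\<bar>)"

definition partial_deriv :: "2 \<Rightarrow> (real^2 \<Rightarrow> real) \<Rightarrow> real^2 \<Rightarrow> real" where
  "partial_deriv i f x = deriv (\<lambda>t. f (x + t *\<^sub>R axis i 1)) 0"

definition gradient :: "(real^2 \<Rightarrow> real) \<Rightarrow> real^2 \<Rightarrow> real^2" where
  "gradient f x = (\<chi> i. partial_deriv i f x)"

text \<open>Derivative for the multi-index \<open>\<alpha> = (\<alpha>\<^sub>1, \<alpha>\<^sub>2)\<close>, of order \<open>\<alpha>\<^sub>1 + \<alpha>\<^sub>2\<close>.\<close>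

definition multi_deriv :: "nat \<times> nat \<Rightarrow> (real^2 \<Rightarrow> real) \<Rightarrow> real^2 \<Rightarrow> real" where
  "multi_deriv \<alpha> f = (partial_deriv 1 ^^ fst \<alpha>) ((partial_deriv 2 ^^ snd \<alpha>) f)"

primrec C_open :: "nat \<Rightarrow> (real^2) set \<Rightarrow> (real^2 \<Rightarrow> real) \<Rightarrow> bool" where
  "C_open 0 S f \<longleftrightarrow> continuous_on S f"
| "C_open (Suc n) S f \<longleftrightarrow> continuous_on S f \<and>
     (\<forall>i. \<forall>x\<in>S. (\<lambda>t. f (x + t *\<^sub>R axis i 1)) field_differentiable (at 0)) \<and>
     (\<forall>i. C_open n S (partial_deriv i f))"

text \<open>On the boundary of an open set \<open>S\<close>, derivatives are understood as the limits of their
  values in \<open>S\<close>; \<open>C_closure n S\<close> is the space usually written \<open>C\<^sup>n\<close> of the closure of \<open>S\<close>.\<close>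

definition boundary_ext :: "(real^2) set \<Rightarrow> (real^2 \<Rightarrow> real) \<Rightarrow> real^2 \<Rightarrow> real" where
  "boundary_ext S g x = (if x \<in> S then g x else Lim (at x within S) g)"

definition C_closure :: "nat \<Rightarrow> (real^2) set \<Rightarrow> (real^2 \<Rightarrow> real) \<Rightarrow> bool" where
  "C_closure n S f \<longleftrightarrow> continuous_on (closure S) f \<and> C_open n S f \<and>
     (\<forall>\<alpha>. fst \<alpha> + snd \<alpha> \<le> n \<longrightarrow>
        continuous_on (closure S) (boundary_ext S (multi_deriv \<alpha> f)))"

definition C0_norm :: "(real^2) set \<Rightarrow> (real^2 \<Rightarrow> real) \<Rightarrow> real" where
  "C0_norm K g = (SUP x\<in>K. \<bar>g x\<bar>)"

definition C_norm :: "nat \<Rightarrow> (real^2) set \<Rightarrow> (real^2 \<Rightarrow> real) \<Rightarrow> real" where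
  "C_norm j S f =
     Max ((\<lambda>\<alpha>. C0_norm (closure S) (boundary_ext S (multi_deriv \<alpha> f))) `
       {\<alpha>. fst \<alpha> + snd \<alpha> = j})"

text \<open>The function \<open>w\<close> is the representative of its class in \<open>L\<^sup>\<infinity>\<close> that is continuous on the closed
  annulus, so that its point values there are meaningful.\<close>

definition weight_function ::
  "(real^2) set \<Rightarrow> real \<Rightarrow> nat \<Rightarrow> (nat \<Rightarrow> real^2) \<Rightarrow> nat \<Rightarrow> real \<Rightarrow> real \<Rightarrow> real \<Rightarrow>
   (real^2 \<Rightarrow> real) \<Rightarrow> bool" where
  "weight_function \<Omega> H N a k h \<delta> L w \<longleftrightarrow>
     w \<in> borel_measurable lebesgue \<and> (\<exists>C. AE x in lebesgue. \<bar>w x\<bar> \<le> C) \<and>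
     continuous_on (closure (annulus h \<delta> 0)) w \<and>
     (AE x in lebesgue. 0 \<le> w x) \<and>
     (AE x in lebesgue. x \<notin> closure (annulus h \<delta> 0) \<longrightarrow> w x = 0) \<and>
     0 \<le> L \<and>
     (\<forall>x\<in>annulus h \<delta> 0. \<forall>y\<in>annulus h \<delta> 0. \<bar>w x - w y\<bar> \<le> L * norm (x - y)) \<and>
     (\<exists>wh. set_integrable lebesgue {\<delta><..<h} wh \<and>
        (AE x in lebesgue. x \<in> annulus h \<delta> 0 \<longrightarrow> w x = wh (norm x))) \<and>
     (\<exists>C0>0. \<forall>x\<in>ball (a k) \<delta>.
        (\<Sum>i\<in>neighbours N a k x h. LINT y:voronoi \<Omega> H N a i|lebesgue. w (x - y)) \<ge> C0 \<and>
        (\<Sum>j\<in>neighbours N a k x h. cell_vol \<Omega> H N a h \<delta> j x * w (x - a j)) \<ge> C0)"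

definition discrete_gradient ::
  "(real^2) set \<Rightarrow> real \<Rightarrow> nat \<Rightarrow> (nat \<Rightarrow> real^2) \<Rightarrow> nat \<Rightarrow> real \<Rightarrow> real \<Rightarrow>
   (real^2 \<Rightarrow> real) \<Rightarrow> (real^2 \<Rightarrow> real) \<Rightarrow> real^2" where
  "discrete_gradient \<Omega> H N a k h \<delta> w f =
     2 *\<^sub>R ((\<Sum>i\<in>neighbours N a k (a k) h.
              (cell_vol \<Omega> H N a h \<delta> i (a k) * ((f (a k) - f (a i)) / norm (a k - a i)) *
                w (a k - a i)) *\<^sub>R ((a k - a i) /\<^sub>R norm (a k - a i)))
           /\<^sub>R (\<Sum>j\<in>neighbours N a k (a k) h. cell_vol \<Omega> H N a h \<delta> j (a k) * w (a k - a j)))"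

end

theory Submission
  imports Defs
begin

text \<open>
  Write \<open>x\<close> for the centre \<open>a k\<close>, \<open>g\<close> for the gradient of \<open>f\<close> at \<open>x\<close>, \<open>A\<close> for the annulus
  \<open>\<delta> < |y - x| < h\<close>, \<open>v y = w (x - y)\<close>, \<open>n\<^sub>y\<close> for the unit vector in direction \<open>x - y\<close>, and
  \<open>r\<close> for \<open>r\<^sub>\<sigma>\<close>. Taylor expansion replaces the difference quotient at \<open>a i\<close> by \<open>n \<bullet> g\<close>, up to
  \<open>2 h |f|\<^sub>C\<^sub>2\<close>; with the factor \<open>2\<close> of the operator this is the first term of the estimate. It
  remains to compare \<open>g\<close> with twice the weighted mean of \<open>(n \<bullet> g) n\<close> over the particles.

  Up to sign, the difference between the two is the weighted mean of the reflections \<open>\<rho>\<^sub>i = 2 (n \<bullet> g) n - g\<close> of \<open>g\<close>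
  in the lines spanned by \<open>x - a i\<close>. Two properties make reflections convenient. They have the norm of
  \<open>g\<close>, so that the error is at most \<open>|g|\<close> whatever the particles are. Turning \<open>n\<close> by a right angle
  changes the sign of the reflection, so that its integral over \<open>A\<close> (or over any concentric annulus)
  against the radial weight vanishes.

  Let \<open>e\<close> be the norm of the error and \<open>q\<close> the component of the reflection in its direction. The sum
  of \<open>V i v (a i) (e - q (a i))\<close> over the particles is zero by the choice of \<open>e\<close> and \<open>q\<close>, while the integral of
  \<open>v (e - q)\<close> is \<open>e\<close> times the mass \<open>T\<close> of the weight. Hence \<open>e T\<close> is the integral of the pointwise
  discrepancy between \<open>v (e - q)\<close> and its step function on the cells, and this is bounded cell by cell
  (lemma \<open>mirror_sum_mass_le\<close>): the cell of \<open>x\<close> gives \<open>c\<^sub>1\<close>; the Lipschitz bound on the weight gives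
  \<open>c\<^sub>2\<close>; the change of direction within a cell gives \<open>r / (\<lambda> h)\<close> when its particle is at distance at
  least \<open>\<lambda> h\<close>, and \<open>c\<^sub>3\<close> otherwise.

  There is one further term. A cell that meets \<open>A\<close> while its particle lies at distance at least \<open>h\<close>
  contributes nothing to the discrete sum. Such cells lie in the shell
  \<open>h - r \<le> |y - x|\<close>, where the integrand is at most \<open>v (|g| - q)\<close>. This function is nonnegative on
  the whole shell and integrates to \<open>|g|\<close> times the mass of the shell. A radial Lipschitz weight cannot
  concentrate on a thin shell without a large Lipschitz constant, so that this mass is controlled by
  \<open>(r / h) T\<close> and \<open>L r h\<^sup>2\<close> (lemma \<open>mass_shell_le\<close>), and both are absorbed into the terms above. This
  argument needs \<open>3 r \<le> h\<close>; otherwise \<open>8 r / (\<lambda> h)\<close> already exceeds the trivial bound. The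
  constants \<open>8, 4, 4, 8\<close> leave just enough room for this, because \<open>|g| \<le> \<surd>2 |f|\<^sub>C\<^sub>1\<close> and
  \<open>\<surd>2 \<le> 10 / 7\<close>.
\<close>

section \<open>Reflections in lines of the plane\<close>

lemma inner_real2: "x \<bullet> y = x $ 1 * y $ 1 + x $ 2 * y $ 2" for x y :: "real^2"
  by (simp add: inner_vec_def sum_2)

lemma norm_real2: "(norm x)\<^sup>2 = (x $ 1)\<^sup>2 + (x $ 2)\<^sup>2" for x :: "real^2"
  unfolding power2_norm_eq_inner inner_real2 by (simp add: power2_eq_square)

text \<open>For a unit vector \<open>n\<close>, the reflection of \<open>g\<close> in the line spanned by \<open>n\<close>.\<close>

definition mirror :: "'a::real_inner \<Rightarrow> 'a \<Rightarrow> 'a" where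
  "mirror n g = (2 * (n \<bullet> g)) *\<^sub>R n - g"

lemma norm_mirror: "norm n = 1 \<Longrightarrow> norm (mirror n g) = norm g"
proof -
  assume n: "norm n = 1"
  then have "n \<bullet> n = 1" by (simp add: norm_eq_1)
  then have "(norm (mirror n g))\<^sup>2 = (norm g)\<^sup>2"
    unfolding power2_norm_eq_inner mirror_def
    by (simp add: inner_diff inner_commute algebra_simps)
  then show ?thesis by simp
qed

definition quarter_turn :: "real^2 \<Rightarrow> real^2" where
  "quarter_turn z = (\<chi> i. if i = 1 then - z $ 2 else z $ 1)"

lemma quarter_turn_nth [simp]:
  "quarter_turn z $ 1 = - z $ 2" "quarter_turn z $ 2 = z $ 1"
  by (simp_all add: quarter_turn_def)

lemma norm_quarter_turn [simp]: "norm (quarter_turn z) = norm z"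
proof -
  have "(norm (quarter_turn z))\<^sup>2 = (norm z)\<^sup>2" by (simp add: norm_real2)
  then show ?thesis by simp
qed

lemma linear_quarter_turn: "linear quarter_turn"
  by (rule linearI) (simp_all add: vec_eq_iff forall_2)

lemma det_quarter_turn: "det (matrix quarter_turn) = 1"
  by (simp add: det_2 matrix_def axis_def)

lemma sgn_quarter_turn: "sgn (quarter_turn z) = quarter_turn (sgn z)"
  by (simp add: sgn_div_norm linear_scale[OF linear_quarter_turn])

lemma mirror_quarter_turn:
  fixes n g :: "real^2"
  assumes "norm n = 1"
  shows "mirror (quarter_turn n) g = - mirror n g"
proof -
  have n: "n $ 1 * n $ 1 + n $ 2 * n $ 2 = 1"
    using assms norm_real2[of n] by (simp add: power2_eq_square)
  have "mirror (quarter_turn n) g $ 1 = - mirror n g $ 1"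
    using n unfolding mirror_def by (simp add: inner_real2) algebra
  moreover have "mirror (quarter_turn n) g $ 2 = - mirror n g $ 2"
    using n unfolding mirror_def by (simp add: inner_real2) algebra
  ultimately show ?thesis by (simp add: vec_eq_iff forall_2)
qed

text \<open>The difference of the two reflections is \<open>2 (n n\<^sup>T - m m\<^sup>T) g\<close>. The matrix \<open>n n\<^sup>T - m m\<^sup>T\<close> is
  symmetric with trace zero, hence in dimension two a multiple of an isometry; the factor is the sine of
  the angle between \<open>n\<close> and \<open>m\<close>.\<close>

lemma norm_mirror_diff:
  fixes n m g :: "real^2"
  assumes "norm n = 1" "norm m = 1"
  shows "norm (mirror n g - mirror m g) = 2 * \<bar>quarter_turn n \<bullet> m\<bar> * norm g"
proof -
  have n: "n $ 1 * n $ 1 + n $ 2 * n $ 2 = 1" and m: "m $ 1 * m $ 1 + m $ 2 * m $ 2 = 1"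
    using assms norm_real2[of n] norm_real2[of m] by (simp_all add: power2_eq_square)
  define \<alpha> where "\<alpha> = n $ 1 * n $ 1 - m $ 1 * m $ 1"
  define \<beta> where "\<beta> = n $ 1 * n $ 2 - m $ 1 * m $ 2"
  have a2: "m $ 2 * m $ 2 - n $ 2 * n $ 2 = \<alpha>" using n m by (simp add: \<alpha>_def)
  have d1: "(mirror n g - mirror m g) $ 1 = 2 * (\<alpha> * g $ 1 + \<beta> * g $ 2)"
    by (simp add: mirror_def inner_real2 \<alpha>_def \<beta>_def algebra_simps)
  have d2: "(mirror n g - mirror m g) $ 2 = 2 * (\<beta> * g $ 1 - \<alpha> * g $ 2)"
    unfolding a2[symmetric] by (simp add: mirror_def inner_real2 \<beta>_def algebra_simps)
  have sq: "\<alpha>\<^sup>2 + \<beta>\<^sup>2 = (quarter_turn n \<bullet> m)\<^sup>2"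
    using n m unfolding \<alpha>_def \<beta>_def inner_real2 quarter_turn_nth by algebra
  have "(norm (mirror n g - mirror m g))\<^sup>2 = 4 * (\<alpha>\<^sup>2 + \<beta>\<^sup>2) * (norm g)\<^sup>2"
    unfolding norm_real2 d1 d2 by (simp add: power2_eq_square algebra_simps)
  also have "\<dots> = (2 * \<bar>quarter_turn n \<bullet> m\<bar> * norm g)\<^sup>2"
    by (simp add: sq power_mult_distrib)
  finally show ?thesis by simp
qed

text \<open>The sine of the angle between \<open>x - y\<close> and \<open>x - z\<close> is the distance from \<open>z\<close> to the line through
  \<open>x\<close> and \<open>y\<close>, divided by \<open>|x - z|\<close>. Bounding the difference of the unit vectors instead would lose a
  factor \<open>2\<close>, which the final constants do not leave room for.\<close>

lemma norm_mirror_direction_diff: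
  fixes x y z g :: "real^2"
  assumes "y \<noteq> x" "z \<noteq> x"
  shows "norm (mirror (sgn (x - y)) g - mirror (sgn (x - z)) g)
           \<le> 2 * (norm (y - z) / norm (x - z)) * norm g"
proof -
  define n where "n = sgn (x - y)"
  have n: "norm n = 1" using assms by (simp add: n_def norm_sgn)
  have "quarter_turn n \<bullet> (x - y) = 0"
    by (simp add: n_def sgn_div_norm inner_real2)
  then have "quarter_turn n \<bullet> (x - z) = quarter_turn n \<bullet> (y - z)"
    by (simp add: inner_diff_right)
  then have "\<bar>quarter_turn n \<bullet> (x - z)\<bar> \<le> norm (y - z)"
    using Cauchy_Schwarz_ineq2[of "quarter_turn n" "y - z"] n by simp
  then have "\<bar>quarter_turn n \<bullet> sgn (x - z)\<bar> \<le> norm (y - z) / norm (x - z)"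
    using assms by (simp add: sgn_div_norm abs_mult divide_inverse mult.commute mult_left_mono)
  then have "2 * \<bar>quarter_turn n \<bullet> sgn (x - z)\<bar> * norm g
      \<le> 2 * (norm (y - z) / norm (x - z)) * norm g"
    by (intro mult_right_mono mult_left_mono) auto
  then show ?thesis
    using norm_mirror_diff[of n "sgn (x - z)" g] n assms by (simp add: n_def norm_sgn)
qed


section \<open>Odd integrands and null sets of the plane\<close>

text \<open>The rotation by a right angle about \<open>x\<close> preserves area, so that the integral equals its own
  negative.\<close>

lemma integral_odd_under_quarter_turn:
  fixes F :: "real^2 \<Rightarrow> real^2"
  assumes F: "integrable lebesgue F"
    and odd: "\<And>y. F (x + quarter_turn (y - x)) = - F y"
  shows "integral\<^sup>L lebesgue F = 0"
proof -
  define g where "g y = x + quarter_turn (y - x)" for y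
  have abs: "F absolutely_integrable_on UNIV"
    using F by (simp add: set_integrable_def)
  have der: "(g has_derivative quarter_turn) (at y within UNIV)" for y
  proof -
    have "bounded_linear quarter_turn"
      using linear_quarter_turn linear_linear by blast
    then show ?thesis
      unfolding g_def by (auto intro!: derivative_eq_intros bounded_linear.has_derivative[of quarter_turn])
  qed
  have qq: "quarter_turn (quarter_turn z) = - z" for z
    by (simp add: vec_eq_iff forall_2)
  have "inj_on g UNIV"
  proof (rule injI)
    fix y z assume "g y = g z"
    then have "quarter_turn (quarter_turn (y - x)) = quarter_turn (quarter_turn (z - x))"
      by (simp add: g_def)
    then show "y = z" by (simp add: qq)
  qed
  moreover have "surj g"
    unfolding surj_def
  proof
    fix y show "\<exists>z. y = g z"
      by (rule exI[of _ "x - quarter_turn (y - x)"])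
        (simp add: g_def linear_neg[OF linear_quarter_turn] qq)
  qed
  ultimately have "integral UNIV (\<lambda>y. \<bar>det (matrix quarter_turn)\<bar> *\<^sub>R F (g y)) = integral UNIV F"
    using has_absolute_integral_change_of_variables[of UNIV g "\<lambda>_. quarter_turn" F "integral UNIV F"]
      der abs by simp
  then have "integral UNIV (\<lambda>y. - F y) = integral UNIV F"
    by (simp add: det_quarter_turn g_def odd)
  then have "2 *\<^sub>R integral UNIV F = 0"
    by (simp add: scaleR_2 neg_eq_iff_add_eq_0)
  then have "integral UNIV F = 0"
    by simp
  then show ?thesis
    using set_lebesgue_integral_eq_integral(2)[OF abs] by (simp add: set_lebesgue_integral_def)
qed

text \<open>The exceptional set for \<open>P \<circ> T\<close> is contained in the image under \<open>S\<close> of the one for \<open>P\<close>, and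
  differentiable maps preserve null sets.\<close>

lemma AE_lebesgue_compose:
  fixes S :: "'a::euclidean_space \<Rightarrow> 'a"
  assumes "AE z in lebesgue. P z" and "S differentiable_on UNIV" and "\<And>y. S (T y) = y"
  shows "AE y in lebesgue. P (T y)"
proof -
  obtain M where M: "M \<in> null_sets lebesgue" "{z. \<not> P z} \<subseteq> M"
    by (rule AE_E3[OF assms(1)]) auto
  have "negligible (S ` M)"
    using M(1) assms(2) differentiable_on_subset
    by (intro negligible_differentiable_image_negligible) (auto simp: negligible_iff_null_sets)
  moreover have "{y. \<not> P (T y)} \<subseteq> S ` M"
  proof
    fix y assume "y \<in> {y. \<not> P (T y)}"
    then have "T y \<in> M" using M(2) by auto
    then show "y \<in> S ` M" using assms(3)[of y] by (metis imageI)
  qed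
  ultimately show ?thesis
    by (intro AE_I'[of "S ` M"]) (auto simp: negligible_iff_null_sets)
qed


section \<open>Second-order remainder in terms of partial derivatives\<close>

text \<open>The mean value theorem along a coordinate axis, the only form in which differentiability enters.
  The point \<open>\<xi>\<close> lies between \<open>0\<close> and \<open>c\<close>; the weaker bound on its absolute value covers both signs
  of \<open>c\<close>.\<close>

lemma partial_deriv_mean_value:
  assumes diff: "\<And>y. y \<in> S \<Longrightarrow> (\<lambda>t. f (y + t *\<^sub>R axis i 1)) field_differentiable (at 0)"
    and S: "\<And>t. \<bar>t\<bar> \<le> \<bar>c\<bar> \<Longrightarrow> y + t *\<^sub>R axis i 1 \<in> S"
  shows "\<exists>\<xi>. \<bar>\<xi>\<bar> \<le> \<bar>c\<bar> \<and>
    f (y + c *\<^sub>R axis i 1) - f y = c * partial_deriv i f (y + \<xi> *\<^sub>R axis i 1)"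
proof -
  define \<phi> where "\<phi> t = f (y + t *\<^sub>R axis i 1)" for t
  have der: "(\<phi> has_field_derivative partial_deriv i f (y + t *\<^sub>R axis i 1)) (at t)" if "\<bar>t\<bar> \<le> \<bar>c\<bar>" for t
  proof -
    have "((\<lambda>s. f ((y + t *\<^sub>R axis i 1) + s *\<^sub>R axis i 1)) has_field_derivative
        partial_deriv i f (y + t *\<^sub>R axis i 1)) (at 0)"
      unfolding partial_deriv_def using diff[OF S[OF that]] by (simp add: DERIV_deriv_iff_field_differentiable)
    moreover have "(\<lambda>s. f ((y + t *\<^sub>R axis i 1) + s *\<^sub>R axis i 1)) = (\<lambda>s. \<phi> (s + t))"
      by (simp add: \<phi>_def algebra_simps)
    ultimately show ?thesis
      using DERIV_shift[of \<phi> _ 0 t] by simp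
  qed
  consider "c > 0" | "c < 0" | "c = 0" by linarith
  then show ?thesis
  proof cases
    case 1
    then obtain \<xi> where "0 < \<xi>" "\<xi> < c"
      "\<phi> c - \<phi> 0 = (c - 0) * partial_deriv i f (y + \<xi> *\<^sub>R axis i 1)"
      using MVT2[of 0 c \<phi> "\<lambda>t. partial_deriv i f (y + t *\<^sub>R axis i 1)"] der by auto
    then show ?thesis by (intro exI[of _ \<xi>]) (auto simp: \<phi>_def)
  next
    case 2
    then obtain \<xi> where "c < \<xi>" "\<xi> < 0"
      "\<phi> 0 - \<phi> c = (0 - c) * partial_deriv i f (y + \<xi> *\<^sub>R axis i 1)"
      using MVT2[of c 0 \<phi> "\<lambda>t. partial_deriv i f (y + t *\<^sub>R axis i 1)"] der by auto
    then show ?thesis by (intro exI[of _ \<xi>]) (auto simp: \<phi>_def)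
  qed auto
qed

text \<open>The increment is followed along the path from \<open>y\<close> parallel to the first axis and then parallel to
  the second one. With this order the only mixed derivative that appears is \<open>\<partial>\<^sub>1 \<partial>\<^sub>2 f\<close>, which is the
  one denoted by the multi-index \<open>(1,1)\<close>; the symmetry of second derivatives is avoided. Each mean
  value step stays in the ball, since moving along the path does not increase the coordinates beyond those of
  \<open>v\<close>.\<close>

lemma gradient_remainder:
  assumes C: "C_open 2 S f" and ball: "ball y \<rho> \<subseteq> S" and v: "norm v < \<rho>"
    and M: "\<And>\<alpha> z. fst \<alpha> + snd \<alpha> = 2 \<Longrightarrow> z \<in> S \<Longrightarrow> \<bar>multi_deriv \<alpha> f z\<bar> \<le> M"
  shows "\<bar>f (y + v) - f y - gradient f y \<bullet> v\<bar> \<le> 2 * M * (norm v)\<^sup>2"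
proof -
  define e :: "2 \<Rightarrow> real^2" where "e i = axis i 1" for i
  define v1 v2 where "v1 = v $ 1" and "v2 = v $ 2"
  have vdec: "v = v1 *\<^sub>R e 1 + v2 *\<^sub>R e 2"
    by (simp add: vec_eq_iff forall_2 v1_def v2_def e_def axis_def)
  have df: "(\<lambda>t. f (z + t *\<^sub>R axis i 1)) field_differentiable (at 0)" if "z \<in> S" for z i
    using C that by (simp add: numeral_2_eq_2)
  have ddf: "(\<lambda>t. partial_deriv j f (z + t *\<^sub>R axis i 1)) field_differentiable (at 0)" if "z \<in> S" for z i j
    using C that by (simp add: numeral_2_eq_2)
  have inS: "y + (s *\<^sub>R e 1 + t *\<^sub>R e 2) \<in> S" if "\<bar>s\<bar> \<le> \<bar>v1\<bar>" "\<bar>t\<bar> \<le> \<bar>v2\<bar>" for s t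
  proof -
    have "(norm (s *\<^sub>R e 1 + t *\<^sub>R e 2))\<^sup>2 = s\<^sup>2 + t\<^sup>2"
      unfolding norm_real2 by (simp add: e_def axis_def)
    also have "\<dots> \<le> v1\<^sup>2 + v2\<^sup>2"
      using that by (intro add_mono) (auto simp: abs_le_square_iff)
    also have "\<dots> = (norm v)\<^sup>2" unfolding norm_real2 by (simp add: v1_def v2_def)
    finally have "norm (s *\<^sub>R e 1 + t *\<^sub>R e 2) \<le> norm v" by (rule power2_le_imp_le) simp
    moreover have "dist y (y + z) = norm z" for z
      by (simp add: dist_norm)
    ultimately show ?thesis using v by (intro subsetD[OF ball]) (simp only: mem_ball)
  qed
  have inS1: "y + s *\<^sub>R e 1 \<in> S" if "\<bar>s\<bar> \<le> \<bar>v1\<bar>" for s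
    using inS[of s 0] that by simp
  obtain s1 where s1: "\<bar>s1\<bar> \<le> \<bar>v1\<bar>"
      "f (y + v1 *\<^sub>R e 1) - f y = v1 * partial_deriv 1 f (y + s1 *\<^sub>R e 1)"
    using partial_deriv_mean_value[OF df, of S v1 y 1] inS1 unfolding e_def by blast
  obtain s2 where s2: "\<bar>s2\<bar> \<le> \<bar>s1\<bar>"
      "partial_deriv 1 f (y + s1 *\<^sub>R e 1) - partial_deriv 1 f y
         = s1 * partial_deriv 1 (partial_deriv 1 f) (y + s2 *\<^sub>R e 1)"
    using partial_deriv_mean_value[OF ddf, of S s1 y 1 1] inS1 s1(1) unfolding e_def
    by (meson order_trans)
  obtain t1 where t1: "\<bar>t1\<bar> \<le> \<bar>v2\<bar>"
      "f (y + v1 *\<^sub>R e 1 + v2 *\<^sub>R e 2) - f (y + v1 *\<^sub>R e 1)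
         = v2 * partial_deriv 2 f (y + v1 *\<^sub>R e 1 + t1 *\<^sub>R e 2)"
    using partial_deriv_mean_value[OF df, of S v2 "y + v1 *\<^sub>R e 1" 2] inS[of v1]
    unfolding e_def add.assoc by blast
  obtain t2 where t2: "\<bar>t2\<bar> \<le> \<bar>t1\<bar>"
      "partial_deriv 2 f (y + v1 *\<^sub>R e 1 + t1 *\<^sub>R e 2) - partial_deriv 2 f (y + v1 *\<^sub>R e 1)
         = t1 * partial_deriv 2 (partial_deriv 2 f) (y + v1 *\<^sub>R e 1 + t2 *\<^sub>R e 2)"
    using partial_deriv_mean_value[OF ddf, of S t1 "y + v1 *\<^sub>R e 1" 2 2] inS[of v1] t1(1)
    unfolding e_def add.assoc by (meson order_trans order_refl)
  obtain s3 where s3: "\<bar>s3\<bar> \<le> \<bar>v1\<bar>"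
      "partial_deriv 2 f (y + v1 *\<^sub>R e 1) - partial_deriv 2 f y
         = v1 * partial_deriv 1 (partial_deriv 2 f) (y + s3 *\<^sub>R e 1)"
    using partial_deriv_mean_value[OF ddf, of S v1 y 1 2] inS1 unfolding e_def by blast
  define A11 A22 A12 where
    "A11 = partial_deriv 1 (partial_deriv 1 f) (y + s2 *\<^sub>R e 1)" and
    "A22 = partial_deriv 2 (partial_deriv 2 f) (y + v1 *\<^sub>R e 1 + t2 *\<^sub>R e 2)" and
    "A12 = partial_deriv 1 (partial_deriv 2 f) (y + s3 *\<^sub>R e 1)"
  have "\<bar>partial_deriv 1 (partial_deriv 1 f) z\<bar> \<le> M" "\<bar>partial_deriv 2 (partial_deriv 2 f) z\<bar> \<le> M"
    "\<bar>partial_deriv 1 (partial_deriv 2 f) z\<bar> \<le> M" if "z \<in> S" for z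
    using M[of "(2,0)" z] M[of "(0,2)" z] M[of "(1,1)" z] that
    by (simp_all add: multi_deriv_def eval_nat_numeral)
  moreover have "y + s2 *\<^sub>R e 1 \<in> S" "y + v1 *\<^sub>R e 1 + t2 *\<^sub>R e 2 \<in> S" "y + s3 *\<^sub>R e 1 \<in> S"
    using inS1[of s2] inS[of v1 t2] inS1[of s3] s1(1) s2(1) t1(1) t2(1) s3(1)
    by (simp_all add: add.assoc)
  ultimately have b: "\<bar>A11\<bar> \<le> M" "\<bar>A22\<bar> \<le> M" "\<bar>A12\<bar> \<le> M"
    by (simp_all add: A11_def A22_def A12_def)
  have grad: "gradient f y \<bullet> v = v1 * partial_deriv 1 f y + v2 * partial_deriv 2 f y"
    by (simp add: inner_real2 gradient_def v1_def v2_def)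
  have fin: "f (y + v) = f (y + v1 *\<^sub>R e 1 + v2 *\<^sub>R e 2)"
    by (simp add: vdec add.assoc)
  have "f (y + v) - f y - gradient f y \<bullet> v = v1 * (s1 * A11) + v2 * (t1 * A22) + v2 * (v1 * A12)"
    using s1(2) s2(2) t1(2) t2(2) s3(2) unfolding grad fin A11_def[symmetric] A22_def[symmetric] A12_def[symmetric]
    by algebra
  also have "\<bar>\<dots>\<bar> \<le> \<bar>v1 * (s1 * A11)\<bar> + \<bar>v2 * (t1 * A22)\<bar> + \<bar>v2 * (v1 * A12)\<bar>" by linarith
  also have "\<dots> \<le> \<bar>v1\<bar> * (\<bar>v1\<bar> * M) + \<bar>v2\<bar> * (\<bar>v2\<bar> * M) + \<bar>v2\<bar> * (\<bar>v1\<bar> * M)"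
    unfolding abs_mult using b s1(1) t1(1) by (intro add_mono mult_mono) auto
  also have "\<dots> = M * (\<bar>v1\<bar>\<^sup>2 + \<bar>v2\<bar>\<^sup>2 + \<bar>v1\<bar> * \<bar>v2\<bar>)"
    by algebra
  also have "\<dots> \<le> M * (2 * (\<bar>v1\<bar>\<^sup>2 + \<bar>v2\<bar>\<^sup>2))"
  proof (rule mult_left_mono)
    have aux: "s + t + p \<le> 2 * (s + t)" if "2 * p \<le> s + t" "0 \<le> s" "0 \<le> t" for s t p :: real
      using that by simp
    show "\<bar>v1\<bar>\<^sup>2 + \<bar>v2\<bar>\<^sup>2 + \<bar>v1\<bar> * \<bar>v2\<bar> \<le> 2 * (\<bar>v1\<bar>\<^sup>2 + \<bar>v2\<bar>\<^sup>2)"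
      by (rule aux) (use sum_squares_bound[of "\<bar>v1\<bar>" "\<bar>v2\<bar>"] in \<open>simp_all add: mult.assoc\<close>)
    show "0 \<le> M" using b by linarith
  qed
  also have "\<dots> = 2 * M * (norm v)\<^sup>2"
    unfolding norm_real2 by (simp add: v1_def v2_def)
  finally show ?thesis .
qed

text \<open>The supremum is finite since the extension to the closure is continuous on a compact set.\<close>

lemma multi_deriv_le_C_norm:
  assumes "C_closure n S f" "bounded S" "fst \<alpha> + snd \<alpha> = j" "j \<le> n" "y \<in> S"
  shows "\<bar>multi_deriv \<alpha> f y\<bar> \<le> C_norm j S f"
proof -
  have "continuous_on (closure S) (boundary_ext S (multi_deriv \<alpha> f))"
    using assms unfolding C_closure_def by blast
  moreover have "compact (closure S)" using assms by (simp add: compact_closure)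
  ultimately have "compact (boundary_ext S (multi_deriv \<alpha> f) ` closure S)"
    by (rule compact_continuous_image)
  then have "bounded (boundary_ext S (multi_deriv \<alpha> f) ` closure S)"
    by (rule compact_imp_bounded)
  then have "bdd_above ((\<lambda>z. \<bar>boundary_ext S (multi_deriv \<alpha> f) z\<bar>) ` closure S)"
    unfolding bounded_iff bdd_above_def by force
  then have "\<bar>boundary_ext S (multi_deriv \<alpha> f) y\<bar>
      \<le> C0_norm (closure S) (boundary_ext S (multi_deriv \<alpha> f))"
    unfolding C0_norm_def using assms closure_subset by (intro cSUP_upper) auto
  also have "\<dots> \<le> C_norm j S f"
    unfolding C_norm_def
  proof (rule Max_ge)
    have "{\<beta>. fst \<beta> + snd \<beta> = j} \<subseteq> {..j} \<times> {..j}" by auto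
    then show "finite ((\<lambda>\<beta>. C0_norm (closure S) (boundary_ext S (multi_deriv \<beta> f))) `
        {\<beta>. fst \<beta> + snd \<beta> = j})"
      by (intro finite_imageI) (rule finite_subset, auto)
  qed (use assms in auto)
  finally show ?thesis using assms(5) by (simp add: boundary_ext_def)
qed

lemma norm_gradient_le:
  assumes "\<And>i. \<bar>partial_deriv i f y\<bar> \<le> G"
  shows "norm (gradient f y) \<le> sqrt 2 * G"
proof -
  have "G \<ge> 0" using assms[of 1] by linarith
  have "(norm (gradient f y))\<^sup>2 = (partial_deriv 1 f y)\<^sup>2 + (partial_deriv 2 f y)\<^sup>2"
    by (simp add: norm_real2 gradient_def)
  also have "\<dots> \<le> G\<^sup>2 + G\<^sup>2"
    using assms \<open>G \<ge> 0\<close> by (intro add_mono) (auto simp: abs_le_square_iff[symmetric])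
  also have "\<dots> = (sqrt 2 * G)\<^sup>2" by (simp add: power_mult_distrib)
  finally show ?thesis by (rule power2_le_imp_le) (use \<open>G \<ge> 0\<close> in simp)
qed

section \<open>Pointwise properties of a radial weight\<close>

lemma open_annulus: "open (annulus h \<delta> x)"
  unfolding annulus_def by (intro open_Collect_conj open_Collect_less continuous_intros)

lemma annulus_conv_ball: "0 < \<delta> \<Longrightarrow> annulus h \<delta> x = ball x h - cball x \<delta>"
  by (auto simp: annulus_def dist_norm norm_minus_commute)

text \<open>The set where \<open>f\<close> is negative is open, and a nonempty open set is not negligible.\<close>

lemma AE_nonneg_imp_nonneg:
  fixes f :: "'a::euclidean_space \<Rightarrow> real"
  assumes U: "open U" and f: "continuous_on U f"
    and ae: "AE z in lebesgue. z \<in> U \<longrightarrow> 0 \<le> f z" and z: "z \<in> U"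
  shows "0 \<le> f z"
proof (rule ccontr)
  assume "\<not> 0 \<le> f z"
  define V where "V = {y \<in> U. f y < 0}"
  have "open V"
  proof -
    have "V = U \<inter> f -` {..<0}" by (auto simp: V_def)
    then show ?thesis using continuous_open_preimage[OF f U, of "{..<0}"] by simp
  qed
  obtain M where M: "M \<in> null_sets lebesgue" "\<And>y. y \<notin> M \<Longrightarrow> y \<in> U \<longrightarrow> 0 \<le> f y"
    by (rule AE_E3[OF ae]) auto
  have "V \<subseteq> M" using M(2) by (force simp: V_def)
  then have "negligible V"
    using M(1) negligible_subset by (auto simp: negligible_iff_null_sets[symmetric])
  moreover have "z \<in> V" using z \<open>\<not> 0 \<le> f z\<close> by (simp add: V_def)
  ultimately show False using open_not_negligible[OF \<open>open V\<close>] by blast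
qed

text \<open>An orthogonal map \<open>T\<close> with \<open>T z = z'\<close> preserves the annulus and null sets, so \<open>w \<circ> T\<close> and \<open>w\<close>
  agree almost everywhere on the annulus, and by continuity everywhere on it.\<close>

lemma AE_radial_imp_radial:
  fixes w :: "real^2 \<Rightarrow> real"
  assumes cont: "continuous_on (annulus h \<delta> 0) w"
    and ae: "AE z in lebesgue. z \<in> annulus h \<delta> 0 \<longrightarrow> w z = wh (norm z)"
    and z: "z \<in> annulus h \<delta> 0" and eq: "norm z = norm z'"
  shows "w z = w z'"
proof -
  obtain T where T: "orthogonal_transformation T" "T z = z'"
    using orthogonal_transformation_exists[OF eq] by blast
  then obtain T' where T': "linear T'" "\<And>y. T' (T y) = y"
    using orthogonal_transformation_inj[OF T(1)] linear_injective_left_inverse[of T]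
    by (metis comp_apply id_apply orthogonal_transformation_linear)
  have "linear T" using T(1) by (rule orthogonal_transformation_linear)
  have nT: "norm (T y) = norm y" for y using T(1) by (rule orthogonal_transformation_norm)
  have inA: "T y \<in> annulus h \<delta> 0 \<longleftrightarrow> y \<in> annulus h \<delta> 0" for y
    by (simp add: annulus_def nT)
  have "T' differentiable_on UNIV"
    using T'(1) linear_linear bounded_linear_imp_differentiable_on by blast
  then have "AE y in lebesgue. T y \<in> annulus h \<delta> 0 \<longrightarrow> w (T y) = wh (norm (T y))"
    using AE_lebesgue_compose[OF ae, of T' T] T'(2) by blast
  then have ae': "AE y in lebesgue. y \<in> annulus h \<delta> 0 \<longrightarrow> w (T y) - w y = 0"
    using ae by eventually_elim (auto simp: inA nT)
  have cT: "continuous_on (annulus h \<delta> 0) (\<lambda>y. w (T y))"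
    by (rule continuous_on_compose2[OF cont])
      (use linear_continuous_on[of T] \<open>linear T\<close> linear_linear inA in auto)
  have "0 \<le> w (T z) - w z"
    by (rule AE_nonneg_imp_nonneg[OF open_annulus _ _ z])
      (use ae' in \<open>auto intro!: continuous_intros cont cT\<close>)
  moreover have "0 \<le> w z - w (T z)"
    by (rule AE_nonneg_imp_nonneg[OF open_annulus _ _ z])
      (use ae' in \<open>auto intro!: continuous_intros cont cT\<close>)
  ultimately show ?thesis using T(2) by simp
qed


section \<open>Voronoi cells\<close>

lemma open_nbhd: "open (nbhd \<Omega> H)"
proof -
  have "nbhd \<Omega> H = (\<Union>y\<in>\<Omega>. ball y H)" by (auto simp: nbhd_def dist_norm norm_minus_commute)
  then show ?thesis by auto
qed

lemma bounded_nbhd: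
  assumes "bounded \<Omega>" shows "bounded (nbhd \<Omega> H)"
proof -
  obtain b where b: "\<And>y. y \<in> \<Omega> \<Longrightarrow> norm y \<le> b" using assms by (auto simp: bounded_iff)
  have "norm x \<le> b + H" if "x \<in> nbhd \<Omega> H" for x
  proof -
    from that obtain y where "y \<in> \<Omega>" "norm (x - y) < H" by (auto simp: nbhd_def)
    then show ?thesis using b[of y] norm_triangle_ineq[of "x - y" y] by simp
  qed
  then show ?thesis by (auto simp: bounded_iff)
qed

lemma open_voronoi: "open (voronoi \<Omega> H N a i)"
proof -
  have "voronoi \<Omega> H N a i = nbhd \<Omega> H \<inter> (\<Inter>j\<in>{1..N} - {i}. {x. norm (x - a i) < norm (x - a j)})"
    by (auto simp: voronoi_def)
  then show ?thesis
    by (auto intro!: open_Int open_nbhd open_INT open_Collect_less continuous_intros)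
qed

lemma voronoi_disjoint:
  "i \<in> {1..N} \<Longrightarrow> j \<in> {1..N} \<Longrightarrow> y \<in> voronoi \<Omega> H N a i \<Longrightarrow> y \<in> voronoi \<Omega> H N a j \<Longrightarrow> i = j"
  by (rule ccontr) (force simp: voronoi_def)

lemma negligible_bisector:
  fixes p q :: "'a::euclidean_space"
  assumes "p \<noteq> q" shows "negligible {y. norm (y - p) = norm (y - q)}"
proof -
  have "norm (y - p) = norm (y - q) \<longleftrightarrow> (2 *\<^sub>R (q - p)) \<bullet> y = q \<bullet> q - p \<bullet> p" for y
    unfolding norm_eq by (auto simp: inner_diff inner_commute algebra_simps)
  then show ?thesis using negligible_hyperplane[of "2 *\<^sub>R (q - p)"] assms by simp
qed

text \<open>A point of the neighbourhood that is in no cell has two nearest generators, and so lies on one of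
  finitely many perpendicular bisectors.\<close>

lemma voronoi_cover:
  assumes inj: "inj_on a {1..N}" and N: "k \<in> {1..N}"
  shows "AE y in lebesgue. y \<in> nbhd \<Omega> H \<longrightarrow> (\<exists>i\<in>{1..N}. y \<in> voronoi \<Omega> H N a i)"
proof -
  define pairs where "pairs = {(i, j). i \<in> {1..N} \<and> j \<in> {1..N} \<and> i \<noteq> j}"
  define M where "M = (\<Union>p\<in>pairs. {y. norm (y - a (fst p)) = norm (y - a (snd p))})"
  have "finite pairs"
    by (rule finite_subset[of _ "{1..N} \<times> {1..N}"]) (auto simp: pairs_def)
  moreover have "negligible {y. norm (y - a (fst p)) = norm (y - a (snd p))}" if "p \<in> pairs" for p
    using that inj_onD[OF inj, of "fst p" "snd p"] by (intro negligible_bisector) (auto simp: pairs_def)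
  ultimately have "negligible M"
    unfolding M_def by (intro negligible_Union) auto
  moreover have "\<exists>i\<in>{1..N}. y \<in> voronoi \<Omega> H N a i" if "y \<notin> M" "y \<in> nbhd \<Omega> H" for y
  proof -
    obtain i where i: "i \<in> {1..N}" "\<And>j. j \<in> {1..N} \<Longrightarrow> norm (y - a i) \<le> norm (y - a j)"
      using ex_is_arg_min_if_finite[of "{1..N}" "\<lambda>i. norm (y - a i)"] N
      by (auto simp: is_arg_min_linorder)
    moreover have "norm (y - a i) \<noteq> norm (y - a j)" if "j \<in> {1..N}" "j \<noteq> i" for j
      using that i(1) \<open>y \<notin> M\<close> by (auto simp: M_def pairs_def)
    ultimately have "y \<in> voronoi \<Omega> H N a i"
      using \<open>y \<in> nbhd \<Omega> H\<close> by (auto simp: voronoi_def less_le)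
    then show ?thesis using i(1) by blast
  qed
  ultimately show ?thesis
    by (intro AE_I'[of M]) (auto simp: negligible_iff_null_sets)
qed

lemma voronoi_radius:
  assumes "bounded \<Omega>" "i \<in> {1..N}" "y \<in> voronoi \<Omega> H N a i"
  shows "norm (y - a i) \<le> r_sigma \<Omega> H N a"
proof -
  have "bounded (closure (voronoi \<Omega> H N a i))"
    by (intro bounded_closure bounded_subset[OF bounded_nbhd[OF assms(1)]]) (auto simp: voronoi_def)
  then obtain b where b: "\<And>z. z \<in> closure (voronoi \<Omega> H N a i) \<Longrightarrow> norm z \<le> b"
    by (auto simp: bounded_iff)
  have "bdd_above ((\<lambda>z. norm (z - a i)) ` closure (voronoi \<Omega> H N a i))"
  proof (rule bdd_aboveI2)
    fix z assume "z \<in> closure (voronoi \<Omega> H N a i)"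
    then show "norm (z - a i) \<le> b + norm (a i)"
      using b[of z] norm_triangle_ineq4[of z "a i"] by linarith
  qed
  then have "norm (y - a i) \<le> (SUP z\<in>closure (voronoi \<Omega> H N a i). norm (z - a i))"
    using assms(3) closure_subset by (intro cSUP_upper) auto
  also have "\<dots> \<le> r_sigma \<Omega> H N a"
    unfolding r_sigma_def using assms(2) by (intro Max_ge) auto
  finally show ?thesis .
qed

text \<open>Otherwise the midpoint of the two generators would be in the ball, hence strictly closer to
  \<open>a k\<close> than to \<open>a i\<close>.\<close>

lemma generator_distance_ge:
  assumes "ball (a k) \<delta> \<subseteq> voronoi \<Omega> H N a k" "i \<in> {1..N}" "i \<noteq> k"
  shows "2 * \<delta> \<le> norm (a k - a i)"
proof (rule ccontr)
  assume less: "\<not> ?thesis"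
  define m where "m = midpoint (a k) (a i)"
  have "dist (a k) m = norm (a k - a i) / 2" by (simp add: m_def dist_midpoint flip: dist_norm)
  then have "dist (a k) m < \<delta>" using less by linarith
  then have "m \<in> voronoi \<Omega> H N a k" using assms(1) by auto
  then have "dist m (a k) < dist m (a i)" using assms(2,3) by (auto simp: voronoi_def dist_norm)
  then show False by (simp add: m_def dist_midpoint)
qed

section \<open>Quadrature of a radial weight by particles\<close>

text \<open>The quadrature problem in isolation: \<open>v\<close> stands for \<open>y \<mapsto> w (x - y)\<close>, replaced by zero off the
  annulus, which changes it only on a null set and makes all its properties hold pointwise. What is kept of the
  Voronoi cells is that they are disjoint, cover the annulus up to a null set, and lie within \<open>r\<close> of
  their generators.\<close>

locale particle_quadrature =
  fixes x :: "real^2" and a :: "nat \<Rightarrow> real^2" and cell :: "nat \<Rightarrow> (real^2) set"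
    and I :: "nat set" and k :: nat and r h \<delta> L lam :: real and v :: "real^2 \<Rightarrow> real"
  assumes finite_I: "finite I" and k_in_I: "k \<in> I"
    and cell_measurable: "i \<in> I \<Longrightarrow> cell i \<in> sets lebesgue"
    and cell_disjoint: "i \<in> I \<Longrightarrow> j \<in> I \<Longrightarrow> y \<in> cell i \<Longrightarrow> y \<in> cell j \<Longrightarrow> i = j"
    and cell_cover: "AE y in lebesgue. y \<in> annulus h \<delta> x \<longrightarrow> (\<exists>i\<in>I. y \<in> cell i)"
    and cell_radius: "i \<in> I \<Longrightarrow> y \<in> cell i \<Longrightarrow> norm (y - a i) \<le> r"
    and separated: "i \<in> I \<Longrightarrow> i \<noteq> k \<Longrightarrow> \<delta> < norm (x - a i)"
    and r_nonneg: "0 \<le> r" and \<delta>_pos: "0 < \<delta>" and \<delta>_less: "2 * \<delta> < h"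
    and L_nonneg: "0 \<le> L" and lam_pos: "0 < lam" and lam_le: "lam \<le> 1"
    and v_nonneg: "0 \<le> v y"
    and v_outside: "y \<notin> annulus h \<delta> x \<Longrightarrow> v y = 0"
    and v_Lipschitz: "y \<in> annulus h \<delta> x \<Longrightarrow> z \<in> annulus h \<delta> x \<Longrightarrow> \<bar>v y - v z\<bar> \<le> L * norm (y - z)"
    and v_radial: "y \<in> annulus h \<delta> x \<Longrightarrow> z \<in> annulus h \<delta> x \<Longrightarrow> norm (y - x) = norm (z - x) \<Longrightarrow> v y = v z"
begin

abbreviation A where "A \<equiv> annulus h \<delta> x"

definition mass :: "(real^2) set \<Rightarrow> real" where
  "mass U = (LINT y|lebesgue. indicator U y * v y)"

text \<open>The particles that the discrete operator sees. Cells of other particles may still meet the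
  annulus.\<close>

definition active :: "nat set" where
  "active = {i \<in> I - {k}. norm (x - a i) < h}"

definition coef :: "nat \<Rightarrow> real" where
  "coef i = measure lebesgue (cell i \<inter> A) * v (a i)"

definition discrete_mass :: real where
  "discrete_mass = (\<Sum>i\<in>active. coef i)"

definition mirror_sum :: "real^2 \<Rightarrow> real^2" where
  "mirror_sum g = (\<Sum>i\<in>active. coef i *\<^sub>R mirror (sgn (x - a i)) g)"

lemma h_pos: "0 < h" using \<delta>_pos \<delta>_less by linarith

lemma A_lmeasurable: "A \<in> lmeasurable"
proof (rule lmeasurable_open[OF _ open_annulus])
  show "bounded A" by (rule bounded_subset[OF bounded_ball[of x h]]) (simp add: annulus_conv_ball \<delta>_pos Diff_subset)
qed

lemma v_borel [measurable]: "v \<in> borel_measurable borel"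
proof -
  have "continuous_on A v"
    using L_nonneg by (intro lipschitz_on_continuous_on[of L] lipschitz_onI) (auto simp: dist_norm v_Lipschitz)
  then have "(\<lambda>y. indicator A y *\<^sub>R v y) \<in> borel_measurable borel"
    using open_annulus by (intro borel_measurable_continuous_on_indicator) auto
  moreover have "(\<lambda>y. indicator A y *\<^sub>R v y) = v"
    by (rule ext) (auto simp: indicator_def v_outside)
  ultimately show ?thesis by simp
qed

lemma v_lebesgue [measurable]: "v \<in> borel_measurable lebesgue"
  by (rule measurable_completion) (simp add: measurable_lborel1)

lemma v_bounded: obtains C where "0 \<le> C" "\<And>y. v y \<le> C * indicator A y"
proof (cases "A = {}")
  case True
  then show ?thesis using that[of 0] v_outside by auto
next
  case False
  then obtain z where z: "z \<in> A" by auto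
  have "v y \<le> v z + L * (2 * h)" if "y \<in> A" for y
  proof -
    have "norm (y - z) \<le> norm (y - x) + norm (z - x)"
      using norm_triangle_ineq4[of "y - x" "z - x"] by simp
    also have "\<dots> \<le> 2 * h" using that z by (simp add: annulus_def)
    finally have "L * norm (y - z) \<le> L * (2 * h)" using L_nonneg by (rule mult_left_mono)
    then show ?thesis using v_Lipschitz[OF that z] by linarith
  qed
  then show ?thesis
    using that[of "v z + L * (2 * h)"] v_nonneg[of z] L_nonneg h_pos v_outside
    by (auto simp: indicator_def)
qed

lemma integrable_v_times:
  fixes F :: "real^2 \<Rightarrow> 'b::{second_countable_topology,banach}"
  assumes [measurable]: "F \<in> borel_measurable lebesgue" and F: "\<And>y. norm (F y) \<le> B"
  shows "integrable lebesgue (\<lambda>y. v y *\<^sub>R F y)"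
proof -
  obtain C where C: "0 \<le> C" "\<And>y. v y \<le> C * indicator A y" using v_bounded by blast
  have "integrable lebesgue (\<lambda>y. C * B * indicator A y)"
    using A_lmeasurable by (simp add: lmeasurable_iff_integrable)
  then show ?thesis
  proof (rule Bochner_Integration.integrable_bound)
    have "norm (v y *\<^sub>R F y) \<le> (C * indicator A y) * B" for y
      using C v_nonneg F[of y] by (simp add: mult_mono)
    also have "(C * indicator A y) * B \<le> norm (C * B * indicator A y)" for y
      by (simp add: mult_ac)
    finally show "AE y in lebesgue. norm (v y *\<^sub>R F y) \<le> norm (C * B * indicator A y)" by simp
  qed measurable
qed

lemma integrable_mass:
  assumes "U \<in> sets lebesgue"
  shows "integrable lebesgue (\<lambda>y. indicator U y * v y)"
proof -
  have "(\<lambda>y. indicator U y :: real) \<in> borel_measurable lebesgue"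
    using assms by measurable
  moreover have "norm (indicator U y :: real) \<le> 1" for y
    by (simp add: indicator_def)
  ultimately have "integrable lebesgue (\<lambda>y. v y *\<^sub>R (indicator U y :: real))"
    by (rule integrable_v_times)
  then show ?thesis by (simp add: mult.commute)
qed

lemma mass_nonneg: "0 \<le> mass U"
  unfolding mass_def by (intro integral_nonneg_AE) (auto simp: v_nonneg)

lemma mass_mono:
  assumes "U \<in> sets lebesgue" "W \<in> sets lebesgue" "U \<subseteq> W"
  shows "mass U \<le> mass W"
  unfolding mass_def using assms v_nonneg
  by (intro integral_mono integrable_mass mult_right_mono) (auto simp: indicator_def)

lemma norm_mirror_sgn: "norm (mirror (sgn z) g) = norm g"
proof (cases "z = 0")
  case True then show ?thesis by (simp add: mirror_def)
next
  case False then show ?thesis by (simp add: norm_mirror norm_sgn)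
qed

lemma mirror_measurable: "(\<lambda>y. mirror (sgn (x - y)) g) \<in> borel_measurable lebesgue"
proof -
  have "(\<lambda>y. mirror (sgn (x - y)) g) \<in> borel_measurable borel"
    unfolding mirror_def sgn_div_norm by measurable
  then show ?thesis by (intro measurable_completion) (simp add: measurable_lborel1)
qed

lemma exterior_measurable [measurable]: "{y. c \<le> norm (y - x)} \<in> sets lebesgue"
proof -
  have "closed {y. c \<le> norm (y - x)}"
    by (intro closed_Collect_le continuous_intros)
  then show ?thesis by (simp add: lmeasurable_compact borel_closed)
qed

text \<open>Used with \<open>c = 0\<close> for the whole annulus and with \<open>c = h - r\<close> for the shell near its outer
  boundary.\<close>

lemma integral_mirror_eq_0:
  "integrable lebesgue (\<lambda>y. (indicator {y. c \<le> norm (y - x)} y * v y) *\<^sub>R mirror (sgn (x - y)) g)"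
  "(LINT y|lebesgue. (indicator {y. c \<le> norm (y - x)} y * v y) *\<^sub>R mirror (sgn (x - y)) g) = 0"
proof -
  define U where "U = {y. c \<le> norm (y - x)}"
  note [measurable] = mirror_measurable
  have [measurable]: "U \<in> sets lebesgue" unfolding U_def by (rule exterior_measurable)
  have "integrable lebesgue (\<lambda>y. v y *\<^sub>R ((indicator U y :: real) *\<^sub>R mirror (sgn (x - y)) g))"
    by (intro integrable_v_times[where B = "norm g"]) (auto simp: norm_mirror_sgn indicator_def)
  then have int: "integrable lebesgue (\<lambda>y. (indicator U y * v y) *\<^sub>R mirror (sgn (x - y)) g)"
    by (simp add: mult.commute)
  have "(LINT y|lebesgue. (indicator U y * v y) *\<^sub>R mirror (sgn (x - y)) g) = 0"
  proof (rule integral_odd_under_quarter_turn[where x = x, OF int])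
    fix y
    define z where "z = x + quarter_turn (y - x)"
    have nz: "norm (z - x) = norm (y - x)" by (simp add: z_def)
    then have U: "indicator U z = (indicator U y :: real)" by (simp add: U_def indicator_def)
    show "(indicator U z * v z) *\<^sub>R mirror (sgn (x - z)) g = - ((indicator U y * v y) *\<^sub>R mirror (sgn (x - y)) g)"
    proof (cases "y \<in> A")
      case True
      then have "z \<in> A" "x - y \<noteq> 0" using nz \<delta>_pos by (auto simp: annulus_def)
      have "x - z = quarter_turn (x - y)"
        using linear_diff[OF linear_quarter_turn] by (simp add: z_def)
      then have "mirror (sgn (x - z)) g = - mirror (sgn (x - y)) g"
        using \<open>x - y \<noteq> 0\<close> by (simp add: sgn_quarter_turn mirror_quarter_turn norm_sgn)
      then show ?thesis using U v_radial[OF True \<open>z \<in> A\<close>] nz by simp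
    next
      case False
      then have "z \<notin> A" using nz by (simp add: annulus_def)
      then show ?thesis using False v_outside by simp
    qed
  qed
  then show "integrable lebesgue (\<lambda>y. (indicator {y. c \<le> norm (y - x)} y * v y) *\<^sub>R mirror (sgn (x - y)) g)"
    "(LINT y|lebesgue. (indicator {y. c \<le> norm (y - x)} y * v y) *\<^sub>R mirror (sgn (x - y)) g) = 0"
    using int by (simp_all add: U_def)
qed

text \<open>By radial symmetry \<open>y\<close> may be moved to the ray through \<open>z\<close> before the Lipschitz bound is
  applied.\<close>

lemma v_diff_norm_le:
  assumes "y \<in> A" "z \<in> A"
  shows "v z \<le> v y + L * \<bar>norm (z - x) - norm (y - x)\<bar>"
proof -
  have z0: "norm (z - x) > 0" using assms \<delta>_pos by (auto simp: annulus_def)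
  define y' where "y' = x + (norm (y - x) / norm (z - x)) *\<^sub>R (z - x)"
  have ny: "norm (y' - x) = norm (y - x)" using z0 by (simp add: y'_def)
  then have y': "y' \<in> A" using assms by (simp add: annulus_def)
  have "z - y' = (1 - norm (y - x) / norm (z - x)) *\<^sub>R (z - x)"
    by (simp add: y'_def scaleR_diff_left)
  then have "norm (z - y') = \<bar>1 - norm (y - x) / norm (z - x)\<bar> * \<bar>norm (z - x)\<bar>"
    by simp
  also have "\<dots> = \<bar>norm (z - x) - norm (y - x)\<bar>"
    unfolding abs_mult[symmetric] using z0 by (simp add: left_diff_distrib)
  finally show ?thesis
    using v_Lipschitz[OF assms(2) y'] v_radial[OF assms(1) y'] ny by simp
qed

text \<open>Let \<open>z\<close> be in the shell and \<open>y\<close> in the annulus \<open>2 h / 3 \<le> |y - x| < h\<close>, whose area is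
  \<open>5 \<pi> h\<^sup>2 / 9\<close>. Then \<open>v z \<le> v y + L h / 3\<close>; averaging over \<open>y\<close> bounds \<open>v z\<close> by the constant \<open>W\<close>
  below, and the area of the shell is at most \<open>2 \<pi> h r\<close>. The inner radius \<open>2 h / 3\<close> is a compromise: a
  larger one makes the averaging area too small, a smaller one the Lipschitz term too large for the
  final constants.\<close>

lemma mass_shell_le:
  assumes r: "3 * r \<le> h"
  shows "mass {y. h - r \<le> norm (y - x)} \<le> 18 / 5 * (r / h) * mass UNIV + 2 / 3 * (pi * L * r * h\<^sup>2)"
proof -
  define B where "B = ball x h - ball x (2 / 3 * h)"
  define sh where "sh = ball x h - ball x (h - r)"
  define W where "W = mass UNIV / (5 / 9 * pi * h\<^sup>2) + L * h / 3"
  have B: "B \<in> lmeasurable" "measure lebesgue B = 5 / 9 * pi * h\<^sup>2"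
    using h_pos measurable_measure_Diff[of "ball x h" lebesgue "ball x (2 / 3 * h)"]
    by (auto simp: B_def circle_area power2_eq_square subset_ball algebra_simps fmeasurable.Diff)
  have sh: "sh \<in> lmeasurable" "measure lebesgue sh = 2 * pi * h * r - pi * r\<^sup>2"
    using h_pos r r_nonneg measurable_measure_Diff[of "ball x h" lebesgue "ball x (h - r)"]
    by (auto simp: sh_def circle_area power2_eq_square subset_ball algebra_simps fmeasurable.Diff)
  have W: "v z \<le> W" if "h - r \<le> norm (z - x)" for z
  proof (cases "z \<in> A")
    case False
    then show ?thesis
      using v_outside mass_nonneg L_nonneg h_pos by (simp add: W_def)
  next
    case True
    have pt: "indicator B y * v z \<le> indicator UNIV y * v y + indicator B y * (L * h / 3)" if "y \<notin> cball x \<delta>" for y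
    proof (cases "y \<in> B")
      case yB: True
      then have "y \<in> A" using that by (auto simp: B_def annulus_conv_ball \<delta>_pos)
      moreover have "\<bar>norm (z - x) - norm (y - x)\<bar> \<le> h / 3"
      proof -
        have "norm (z - x) < h" "norm (y - x) < h" "2 / 3 * h \<le> norm (y - x)"
          using yB True by (auto simp: B_def annulus_def dist_norm norm_minus_commute)
        then show ?thesis using r \<open>h - r \<le> norm (z - x)\<close> by linarith
      qed
      ultimately have "v z \<le> v y + L * (h / 3)"
        using v_diff_norm_le[OF _ True, of y] mult_left_mono[OF _ L_nonneg]
        by (meson add_left_mono order_trans)
      then show ?thesis using yB by simp
    qed (simp add: v_nonneg)
    have pt: "indicator B y * v z \<le> indicator UNIV y * v y + indicator B y * (L * h / 3)" for y
    proof (cases "y \<in> cball x \<delta>")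
      case True
      then have "y \<notin> B" using \<delta>_less \<delta>_pos by (auto simp: B_def)
      then show ?thesis by (simp add: v_nonneg)
    qed (rule pt)
    have intB: "integrable lebesgue (\<lambda>y. indicator B y * c)" for c :: real
      using B by (simp add: lmeasurable_iff_integrable)
    have "(LINT y|lebesgue. indicator B y * v z)
        \<le> (LINT y|lebesgue. indicator UNIV y * v y + indicator B y * (L * h / 3))"
      using pt by (intro integral_mono intB Bochner_Integration.integrable_add integrable_mass) auto
    also have "\<dots> = mass UNIV + (LINT y|lebesgue. indicator B y * (L * h / 3))"
      unfolding mass_def by (intro Bochner_Integration.integral_add intB integrable_mass) auto
    finally have "measure lebesgue B * v z \<le> mass UNIV + measure lebesgue B * (L * h / 3)"
      by simp
    then show ?thesis
      using h_pos unfolding W_def B(2) by (simp add: field_simps)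
  qed
  have "mass {y. h - r \<le> norm (y - x)} \<le> (LINT y|lebesgue. indicator sh y * W)"
    unfolding mass_def
  proof (intro integral_mono integrable_mass exterior_measurable)
    fix y
    show "indicator {y. h - r \<le> norm (y - x)} y * v y \<le> indicator sh y * W"
      using W[of y] v_outside[of y] v_nonneg[of y]
      by (auto simp: sh_def indicator_def annulus_def dist_norm norm_minus_commute)
  qed (use sh in \<open>auto simp: fmeasurable_def\<close>)
  also have "\<dots> = measure lebesgue sh * W" using sh by (simp add: fmeasurable_def)
  also have "\<dots> \<le> 2 * pi * h * r * W"
    unfolding sh(2) using mass_nonneg L_nonneg h_pos by (intro mult_right_mono) (auto simp: W_def)
  also have "\<dots> = 18 / 5 * (r / h) * mass UNIV + 2 / 3 * (pi * L * r * h\<^sup>2)"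
    using h_pos by (simp add: W_def field_simps power2_eq_square)
  finally show ?thesis .
qed

lemma active_subset: "active \<subseteq> I" and finite_active: "finite active"
  unfolding active_def using finite_I by auto

lemma generator_in_annulus: "i \<in> active \<Longrightarrow> a i \<in> A"
  using separated by (auto simp: active_def annulus_def norm_minus_commute)

lemma coef_nonneg: "0 \<le> coef i"
  by (simp add: coef_def v_nonneg)

lemma norm_mirror_sum_le: "norm (mirror_sum g) \<le> norm g * discrete_mass"
proof -
  have "norm (mirror_sum g) \<le> (\<Sum>i\<in>active. norm (coef i *\<^sub>R mirror (sgn (x - a i)) g))"
    unfolding mirror_sum_def by (rule norm_sum)
  also have "\<dots> = norm g * discrete_mass"
    by (simp add: discrete_mass_def sum_distrib_left norm_mirror_sgn coef_nonneg mult.commute)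
  finally show ?thesis .
qed

text \<open>The discrepancy argument. With \<open>e\<close> and \<open>q\<close> as in the introduction, \<open>\<Phi>\<close> is \<open>v (e - q)\<close> minus its
  step function on the cells, and its integral is \<open>e\<close> times the total mass; \<open>\<Psi>\<close> collects the bounds
  for the different kinds of cells, each extended to a nonnegative function on the plane so that the
  cases can be treated separately.\<close>

lemma mirror_sum_mass_le:
  assumes "0 < discrete_mass"
  shows "norm (mirror_sum g) / discrete_mass * mass UNIV
    \<le> norm g * (2 * mass (cell k) + 2 * (pi * L * r * h\<^sup>2) + 2 * (r / (lam * h)) * mass (- cell k)
        + 2 * mass (ball x (lam * h + r) - cell k) + mass {y. h - r \<le> norm (y - x)})"
proof -
  define G where "G = norm g"
  define e where "e = norm (mirror_sum g) / discrete_mass"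
  define u where "u = sgn (mirror_sum g)"
  define q where "q y = mirror (sgn (x - y)) g \<bullet> u" for y
  define sh where "sh = {y. h - r \<le> norm (y - x)}"
  define near where "near = ball x (lam * h + r) - cell k"
  note [measurable] = cell_measurable[OF k_in_I]
  have [measurable]: "sh \<in> sets lebesgue" "near \<in> sets lebesgue"
    by (auto simp: sh_def near_def)
  have G0: "0 \<le> G" by (simp add: G_def)
  have e: "e \<le> G" "0 \<le> e"
    using norm_mirror_sum_le[of g] assms by (auto simp: e_def G_def divide_le_eq)
  have nu: "norm u \<le> 1" by (simp add: u_def norm_sgn)
  \<comment> \<open>Since \<open>u\<close> is the direction of the error, the sum of \<open>e - q (a i)\<close> against the discrete weights
    vanishes; for a vanishing error \<open>u = 0\<close> and the identity is trivial.\<close>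
  have Su: "mirror_sum g \<bullet> u = e * discrete_mass"
    using assms by (cases "mirror_sum g = 0") (simp_all add: u_def e_def sgn_div_norm dot_square_norm power2_eq_square)
  have q: "\<bar>q y\<bar> \<le> G" for y
  proof -
    have "\<bar>q y\<bar> \<le> norm (mirror (sgn (x - y)) g) * norm u"
      unfolding q_def by (rule Cauchy_Schwarz_ineq2)
    also have "\<dots> \<le> G * 1"
      unfolding norm_mirror_sgn G_def using nu by (intro mult_left_mono) auto
    finally show ?thesis by simp
  qed
  have qdiff: "\<bar>q y - q z\<bar> \<le> 2 * (norm (y - z) / norm (x - z)) * G" if "y \<noteq> x" "z \<noteq> x" for y z
  proof -
    have "\<bar>q y - q z\<bar> \<le> norm (mirror (sgn (x - y)) g - mirror (sgn (x - z)) g) * norm u"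
      unfolding q_def inner_diff_left[symmetric] by (rule Cauchy_Schwarz_ineq2)
    also have "\<dots> \<le> norm (mirror (sgn (x - y)) g - mirror (sgn (x - z)) g) * 1"
      using nu by (intro mult_left_mono) auto
    finally show ?thesis using norm_mirror_direction_diff[OF that, of g] by (simp add: G_def)
  qed
  define \<Phi> where "\<Phi> y = indicator UNIV y * v y * e - (indicator {y. 0 \<le> norm (y - x)} y * v y) * q y
      - (\<Sum>i\<in>active. indicator (cell i \<inter> A) y * (v (a i) * (e - q (a i))))" for y
  define \<Psi> where "\<Psi> y = indicator (cell k) y * v y * (2 * G) + indicator A y * (L * r * (2 * G))
      + indicator (- cell k) y * v y * (2 * (r / (lam * h)) * G)
      + indicator near y * v y * (2 * G)
      + indicator sh y * v y * G - (indicator sh y * v y) * q y" for y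
  have qint: "integrable lebesgue (\<lambda>y. (indicator {y. c \<le> norm (y - x)} y * v y) * q y)"
    "(LINT y|lebesgue. (indicator {y. c \<le> norm (y - x)} y * v y) * q y) = 0" for c
    using integral_mirror_eq_0[of c g] by (simp_all add: q_def flip: inner_scaleR_left)
  have cellA: "cell i \<inter> A \<in> lmeasurable" if "i \<in> I" for i
    using cell_measurable[OF that] A_lmeasurable by (metis fmeasurable.Int fmeasurable_Int_fmeasurable inf_commute)
  have intcell: "integrable lebesgue (\<lambda>y. indicator (cell i \<inter> A) y * c)" if "i \<in> I" for i and c :: real
    using cellA[OF that] by (simp add: lmeasurable_iff_integrable)
  have intv: "integrable lebesgue (\<lambda>y. indicator UNIV y * v y * e)"
    by (intro integrable_mult_left integrable_mass) auto
  have intsum: "integrable lebesgue (\<lambda>y. \<Sum>i\<in>active. indicator (cell i \<inter> A) y * (v (a i) * (e - q (a i))))"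
    using active_subset by (intro Bochner_Integration.integrable_sum intcell) auto
  have int\<Phi>: "integrable lebesgue \<Phi>"
    unfolding \<Phi>_def by (intro Bochner_Integration.integrable_diff intv qint(1) intsum)
  have "integral\<^sup>L lebesgue \<Phi> = (LINT y|lebesgue. indicator UNIV y * v y * e)
      - (LINT y|lebesgue. (indicator {y. 0 \<le> norm (y - x)} y * v y) * q y)
      - (LINT y|lebesgue. (\<Sum>i\<in>active. indicator (cell i \<inter> A) y * (v (a i) * (e - q (a i)))))"
    unfolding \<Phi>_def using intv qint(1)[of 0] intsum
    by (simp only: Bochner_Integration.integral_diff Bochner_Integration.integrable_diff)
  also have "(LINT y|lebesgue. indicator UNIV y * v y * e) = mass UNIV * e"
    by (simp add: mass_def)
  also have "(LINT y|lebesgue. (\<Sum>i\<in>active. indicator (cell i \<inter> A) y * (v (a i) * (e - q (a i)))))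
      = (\<Sum>i\<in>active. (LINT y|lebesgue. indicator (cell i \<inter> A) y * (v (a i) * (e - q (a i)))))"
    using active_subset by (intro Bochner_Integration.integral_sum intcell) auto
  also have "\<dots> = (\<Sum>i\<in>active. measure lebesgue (cell i \<inter> A) * (v (a i) * (e - q (a i))))"
    by simp
  also note qint(2)[of 0]
  also have "(\<Sum>i\<in>active. measure lebesgue (cell i \<inter> A) * (v (a i) * (e - q (a i)))) = e * discrete_mass - mirror_sum g \<bullet> u"
    by (simp add: discrete_mass_def mirror_sum_def coef_def q_def inner_sum_left sum_distrib_left sum_subtractf[symmetric] algebra_simps)
  finally have L: "integral\<^sup>L lebesgue \<Phi> = e * mass UNIV" by (simp add: Su mult.commute)
  have intA: "integrable lebesgue (\<lambda>y. indicator A y * (L * r * (2 * G)))"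
    using A_lmeasurable by (simp add: lmeasurable_iff_integrable)
  have compl: "- cell k \<in> sets lebesgue" by (simp add: Compl_in_sets_lebesgue)
  have intU: "integrable lebesgue (\<lambda>y. indicator U y * v y * c)" if "U \<in> sets lebesgue" for U c
    using that by (intro integrable_mult_left integrable_mass)
  have intsh: "integrable lebesgue (\<lambda>y. (indicator sh y * v y) * q y)"
    "(LINT y|lebesgue. (indicator sh y * v y) * q y) = 0"
    using qint[of "h - r"] by (simp_all add: sh_def)
  have sets: "sh \<in> sets lebesgue" "near \<in> sets lebesgue" "cell k \<in> sets lebesgue" by measurable
  note ints = intU[OF compl, of "2 * (r / (lam * h)) * G"] intU[OF sets(1), of G]
    intU[OF sets(2), of "2 * G"] intU[OF sets(3), of "2 * G"] intA intsh(1)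
  have int\<Psi>: "integrable lebesgue \<Psi>"
    unfolding \<Psi>_def
    by (intro Bochner_Integration.integrable_diff Bochner_Integration.integrable_add ints)
  have R: "integral\<^sup>L lebesgue \<Psi> = mass (cell k) * (2 * G) + measure lebesgue A * (L * r * (2 * G))
      + mass (- cell k) * (2 * (r / (lam * h)) * G) + mass near * (2 * G) + mass sh * G - 0"
  proof -
    have "integral\<^sup>L lebesgue \<Psi> = (LINT y|lebesgue. indicator (cell k) y * v y * (2 * G))
      + (LINT y|lebesgue. indicator A y * (L * r * (2 * G)))
      + (LINT y|lebesgue. indicator (- cell k) y * v y * (2 * (r / (lam * h)) * G))
      + (LINT y|lebesgue. indicator near y * v y * (2 * G))
      + (LINT y|lebesgue. indicator sh y * v y * G)
      - (LINT y|lebesgue. (indicator sh y * v y) * q y)"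
      unfolding \<Psi>_def using ints
      by (simp only: Bochner_Integration.integral_diff Bochner_Integration.integral_add
          Bochner_Integration.integrable_add)
    then show ?thesis unfolding intsh(2) by (simp add: mass_def)
  qed
  have "\<Phi> y \<le> \<Psi> y" if y: "y \<in> A \<longrightarrow> (\<exists>i\<in>I. y \<in> cell i)" for y
  proof (cases "y \<in> A")
    case False
    then show ?thesis by (simp add: \<Phi>_def \<Psi>_def v_outside)
  next
    case True
    then obtain i where i: "i \<in> I" "y \<in> cell i" using y by blast
    have yx: "y \<noteq> x" using True \<delta>_pos by (auto simp: annulus_def)
    have v0: "0 \<le> v y" by (rule v_nonneg)
    have ind: "indicator (cell j \<inter> A) y = (if j = i then 1 else 0 :: real)" if "j \<in> I" for j
    proof -
      have "y \<in> cell j \<longleftrightarrow> j = i"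
        using cell_disjoint[OF that i(1) _ i(2)] i(2) by blast
      then show ?thesis using True i(2) by (simp add: indicator_def)
    qed
    have sum: "(\<Sum>j\<in>active. indicator (cell j \<inter> A) y * (v (a j) * (e - q (a j))))
        = (if i \<in> active then v (a i) * (e - q (a i)) else 0)"
    proof -
      have "(\<Sum>j\<in>active. indicator (cell j \<inter> A) y * (v (a j) * (e - q (a j))))
        = (\<Sum>j\<in>active. if j = i then v (a j) * (e - q (a j)) else 0)"
        using active_subset ind by (intro sum.cong) (auto simp: subset_iff)
      then show ?thesis using finite_active by simp
    qed
    have \<Phi>: "\<Phi> y = v y * (e - q y) - (if i \<in> active then v (a i) * (e - q (a i)) else 0)"
      unfolding \<Phi>_def sum by (simp add: right_diff_distrib)
    \<comment> \<open>This holds at every point of the shell, whatever the kind of its cell; with \<open>e\<close> in place of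
      \<open>G\<close> it could fail.\<close>
    have shq: "0 \<le> indicator sh y * v y * G - (indicator sh y * v y) * q y"
      using q[of y] v0 by (simp add: indicator_def mult_left_mono)
    have LrG: "0 \<le> L * r * (2 * G)" using L_nonneg r_nonneg G0 by simp
    have rlh: "0 \<le> r / (lam * h)" using r_nonneg lam_pos h_pos by simp
    consider "i = k" | "i \<noteq> k" "i \<in> active" | "i \<noteq> k" "i \<notin> active" by blast
    then show ?thesis
    proof cases
      case 1
      then have "\<Phi> y = v y * (e - q y)" by (simp add: \<Phi> active_def)
      also have "\<dots> \<le> v y * (2 * G)"
        using q[of y] e v0 by (intro mult_left_mono) auto
      also have "\<dots> \<le> \<Psi> y"
        using 1 i True shq LrG v0 G0 by (simp add: \<Psi>_def near_def)
      finally show ?thesis .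
    next
      case 2
      have yk: "y \<notin> cell k" using cell_disjoint[OF i(1) k_in_I i(2)] 2 by auto
      have ai: "a i \<in> A" "a i \<noteq> x"
        using generator_in_annulus[OF 2(2)] \<delta>_pos by (auto simp: annulus_def)
      have ya: "norm (y - a i) \<le> r" by (rule cell_radius[OF i])
      have "\<bar>v y - v (a i)\<bar> * \<bar>e - q (a i)\<bar> \<le> (L * r) * (2 * G)"
      proof (rule mult_mono)
        show "\<bar>v y - v (a i)\<bar> \<le> L * r"
          using v_Lipschitz[OF True ai(1)] mult_left_mono[OF ya L_nonneg] by linarith
        show "\<bar>e - q (a i)\<bar> \<le> 2 * G" using e q[of "a i"] by linarith
      qed (use L_nonneg r_nonneg in auto)
      then have 1: "(v y - v (a i)) * (e - q (a i)) \<le> L * r * (2 * G)"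
        unfolding abs_mult[symmetric] by linarith
      have 2: "q (a i) - q y \<le> 2 * (r / (lam * h)) * G + indicator near y * (2 * G)"
      proof (cases "norm (x - a i) < lam * h")
        case True
        have "norm (y - x) \<le> norm (y - a i) + norm (x - a i)"
          using norm_triangle_ineq4[of "y - a i" "x - a i"] by simp
        then have "y \<in> near" using True ya yk by (simp add: near_def dist_norm norm_minus_commute)
        have "q (a i) - q y \<le> 2 * G" using q[of y] q[of "a i"] by linarith
        moreover have "0 \<le> 2 * (r / (lam * h)) * G" using rlh G0 by (intro mult_nonneg_nonneg) auto
        ultimately show ?thesis unfolding indicator_simps(1)[OF \<open>y \<in> near\<close>] by linarith
      next
        case False
        have "norm (y - a i) / norm (x - a i) \<le> r / (lam * h)"
          using False ya r_nonneg lam_pos h_pos by (intro frac_le) auto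
        then have "2 * (norm (y - a i) / norm (x - a i)) * G \<le> 2 * (r / (lam * h)) * G"
          using G0 by (intro mult_right_mono mult_left_mono) auto
        then have "q (a i) - q y \<le> 2 * (r / (lam * h)) * G"
          using qdiff[OF yx ai(2)] by linarith
        then show ?thesis using G0 by (simp add: add_increasing2)
      qed
      have "\<Phi> y = (v y - v (a i)) * (e - q (a i)) + v y * (q (a i) - q y)"
        using \<open>i \<in> active\<close> by (simp add: \<Phi> algebra_simps)
      also have "\<dots> \<le> L * r * (2 * G) + v y * (2 * (r / (lam * h)) * G + indicator near y * (2 * G))"
        using 1 2 v0 by (intro add_mono mult_left_mono) auto
      also have "\<dots> \<le> \<Psi> y"
        using yk True shq by (simp add: \<Psi>_def algebra_simps)
      finally show ?thesis .
    next
      case 3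
      have yk: "y \<notin> cell k" using cell_disjoint[OF i(1) k_in_I i(2)] 3 by auto
      have "h \<le> norm (x - a i)" using 3 i by (auto simp: active_def)
      moreover have "norm (x - a i) \<le> norm (y - x) + norm (y - a i)"
        using norm_triangle_ineq4[of "y - a i" "y - x"] by simp
      ultimately have "y \<in> sh" using cell_radius[OF i] by (simp add: sh_def)
      have "\<Phi> y = v y * (e - q y)" using 3 by (simp add: \<Phi>)
      also have "\<dots> \<le> v y * (G - q y)" using e v0 by (intro mult_left_mono) auto
      also have "\<dots> = indicator sh y * v y * G - (indicator sh y * v y) * q y"
        using \<open>y \<in> sh\<close> by (simp add: right_diff_distrib)
      also have "\<dots> \<le> \<Psi> y"
      proof -
        have "\<Psi> y = L * r * (2 * G) + v y * (2 * (r / (lam * h)) * G) + indicator near y * v y * (2 * G)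
            + (indicator sh y * v y * G - (indicator sh y * v y) * q y)"
          using yk True by (simp add: \<Psi>_def)
        moreover have "0 \<le> v y * (2 * (r / (lam * h)) * G)" "0 \<le> indicator near y * v y * (2 * G)"
          using rlh v0 G0 by (intro mult_nonneg_nonneg; simp)+
        ultimately show ?thesis using LrG by linarith
      qed
      finally show ?thesis .
    qed
  qed
  then have "AE y in lebesgue. \<Phi> y \<le> \<Psi> y"
    using cell_cover by auto
  then have "integral\<^sup>L lebesgue \<Phi> \<le> integral\<^sup>L lebesgue \<Psi>"
    by (rule integral_mono_AE[OF int\<Phi> int\<Psi>])
  moreover have "measure lebesgue A * (L * r * (2 * G)) \<le> pi * h\<^sup>2 * (L * r * (2 * G))"
  proof (rule mult_right_mono)
    have "measure lebesgue A \<le> measure lebesgue (ball x h)"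
      using A_lmeasurable by (intro measure_mono_fmeasurable) (auto simp: annulus_conv_ball \<delta>_pos fmeasurableD)
    then show "measure lebesgue A \<le> pi * h\<^sup>2"
      using h_pos by (simp add: circle_area mult.commute)
  qed (use L_nonneg r_nonneg G0 in simp)
  ultimately show ?thesis
    unfolding L R e_def[symmetric] G_def[symmetric] sh_def[symmetric] near_def[symmetric]
    by (simp add: algebra_simps)
qed

text \<open>The factor \<open>7 / 10\<close> anticipates the loss \<open>\<surd>2 \<le> 10 / 7\<close> in the passage from \<open>|g|\<close> to \<open>|f|\<^sub>C\<^sub>1\<close>.\<close>

theorem relative_mirror_sum_le:
  assumes D_pos: "0 < discrete_mass" and P: "0 < mass (- cell k)"
  shows "norm (mirror_sum g) / discrete_mass \<le> norm g * (7 / 10 * (8 * r / (lam * h) + 4 * (mass (cell k) / mass UNIV)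
    + 4 * (pi * L * r * h\<^sup>2 / mass (- cell k))
    + 8 * (mass (ball x (lam * h + r) - cell k) / mass (- cell k))))"
proof -
  define T where "T = mass UNIV"
  define P' where "P' = mass (- cell k)"
  define Q where "Q = mass (cell k)"
  define K where "K = pi * L * r * h\<^sup>2"
  define M where "M = mass (ball x (lam * h + r) - cell k)"
  define \<rho> where "\<rho> = r / (lam * h)"
  define c1 c2 c3 where "c1 = Q / T" and "c2 = K / P'" and "c3 = M / P'"
  define bound where "bound = 7 / 10 * (8 * \<rho> + 4 * c1 + 4 * c2 + 8 * c3)"
  have PT: "0 < P'" "P' \<le> T"
    using P cell_measurable[OF k_in_I] by (auto simp: P'_def T_def Compl_in_sets_lebesgue intro!: mass_mono)
  have nn: "0 \<le> Q" "0 \<le> K" "0 \<le> M"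
    using mass_nonneg L_nonneg r_nonneg by (auto simp: Q_def K_def M_def)
  have rho: "r / h \<le> \<rho>" "0 \<le> r / h"
    using r_nonneg lam_pos lam_le h_pos by (auto simp: \<rho>_def intro!: divide_left_mono mult_left_le_one_le)
  have "norm (mirror_sum g) / discrete_mass \<le> norm g * bound"
  proof (cases "3 * r \<le> h")
    case False
    \<comment> \<open>For so coarse a cell the trivial bound \<open>|g|\<close> on the error is enough, as
      \<open>7 / 10 * 8 / 3 \<ge> 1\<close>.\<close>
    then have "1 / 3 \<le> r / h" using h_pos by (simp add: field_simps)
    then have "1 / 3 \<le> \<rho>" using rho(1) by (rule order_trans)
    moreover have "0 \<le> c1" "0 \<le> c2" "0 \<le> c3" using nn PT by (auto simp: c1_def c2_def c3_def)
    ultimately have "1 \<le> bound" unfolding bound_def by argo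
    have "norm (mirror_sum g) / discrete_mass \<le> norm g" using norm_mirror_sum_le[of g] D_pos by (simp add: divide_le_eq)
    also have "\<dots> \<le> norm g * bound" using \<open>1 \<le> bound\<close> by (simp add: mult_le_cancel_left1)
    finally show ?thesis .
  next
    case True
    have "norm (mirror_sum g) / discrete_mass * T \<le> norm g * (2 * Q + 2 * K + 2 * \<rho> * P' + 2 * M + mass {y. h - r \<le> norm (y - x)})"
      using mirror_sum_mass_le[OF D_pos] by (simp add: T_def Q_def K_def \<rho>_def P'_def M_def)
    also have "\<dots> \<le> norm g * (bound * T)"
    proof (rule mult_left_mono)
      have shell: "mass {y. h - r \<le> norm (y - x)} \<le> 18 / 5 * (r / h * T) + 2 / 3 * K"
        using mass_shell_le[OF True] by (simp add: T_def K_def)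
      have rT: "r / h * T \<le> \<rho> * T"
        using rho PT by (intro mult_right_mono) auto
      have rP: "\<rho> * P' \<le> \<rho> * T"
        using rho PT by (intro mult_left_mono) auto
      have KM: "K \<le> c2 * T" "M \<le> c3 * T"
        using PT nn by (auto simp: field_simps c2_def c3_def intro: mult_left_mono)
      have "c1 * T = Q" using PT by (simp add: c1_def)
      then have bT: "bound * T = 28 / 5 * (\<rho> * T) + 14 / 5 * Q + 14 / 5 * (c2 * T) + 28 / 5 * (c3 * T)"
        by (simp add: bound_def algebra_simps)
      \<comment> \<open>The coefficients after adding the shell mass: \<open>18 / 5 + 2 = 28 / 5\<close> for \<open>r / (\<lambda> h)\<close>, with
        nothing to spare, and \<open>2 + 2 / 3 \<le> 14 / 5\<close> for the Lipschitz term.\<close>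
      have arith: "2 * Q + 2 * K + 2 * z + 2 * M + m \<le> 28 / 5 * y + 14 / 5 * Q + 14 / 5 * s + 28 / 5 * t"
        if "m \<le> 18 / 5 * s' + 2 / 3 * K" "s' \<le> y" "z \<le> y" "K \<le> s" "M \<le> t" for m s' y z s t
        using that nn by linarith
      show "2 * Q + 2 * K + 2 * \<rho> * P' + 2 * M + mass {y. h - r \<le> norm (y - x)} \<le> bound * T"
        unfolding bT mult.assoc[of 2 \<rho>] by (rule arith[OF shell rT rP KM])
    qed simp
    finally have "norm (mirror_sum g) / discrete_mass * T \<le> norm g * bound * T" by (simp only: mult.assoc)
    then show ?thesis by (rule mult_right_le_imp_le) (use PT in simp)
  qed
  then show ?thesis unfolding bound_def c1_def c2_def c3_def \<rho>_def Q_def T_def K_def P'_def M_def by simp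
qed

lemma mass_cong: "(\<And>y. y \<in> A \<Longrightarrow> y \<in> U \<longleftrightarrow> y \<in> W) \<Longrightarrow> mass U = mass W"
  unfolding mass_def using v_outside by (intro Bochner_Integration.integral_cong) (auto simp: indicator_def)

text \<open>The error splits into a reflection mean and the perturbation of the difference quotients. Here
  \<open>2 (n \<bullet> g) n = \<rho> + g\<close> turns the discrete operator, applied to exact directional derivatives, into
  \<open>g\<close> plus the mean of the reflections \<open>\<rho>\<close>.\<close>

lemma gradient_error_le:
  assumes D_pos: "0 < discrete_mass" and \<phi>: "\<And>i. i \<in> active \<Longrightarrow> \<bar>\<phi> i - sgn (x - a i) \<bullet> g\<bar> \<le> \<epsilon>"
  shows "norm (g - 2 *\<^sub>R ((\<Sum>i\<in>active. (coef i * \<phi> i) *\<^sub>R sgn (x - a i)) /\<^sub>R discrete_mass)) \<le> 2 * \<epsilon> + norm (mirror_sum g) / discrete_mass"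
proof -
  define n where "n i = sgn (x - a i)" for i
  define R where "R = (\<Sum>i\<in>active. (coef i * (\<phi> i - n i \<bullet> g)) *\<^sub>R n i)"
  have split: "2 *\<^sub>R (\<Sum>i\<in>active. (coef i * \<phi> i) *\<^sub>R n i) = mirror_sum g + discrete_mass *\<^sub>R g + 2 *\<^sub>R R"
    unfolding mirror_sum_def discrete_mass_def R_def mirror_def n_def[symmetric] scaleR_sum_right scaleR_sum_left sum.distrib[symmetric]
    by (intro sum.cong refl) (simp add: algebra_simps)
  have "norm R \<le> (\<Sum>i\<in>active. norm ((coef i * (\<phi> i - n i \<bullet> g)) *\<^sub>R n i))"
    unfolding R_def by (rule norm_sum)
  also have "\<dots> \<le> (\<Sum>i\<in>active. coef i * \<epsilon>)"
  proof (rule sum_mono)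
    fix i assume "i \<in> active"
    have "norm (n i) \<le> 1" by (simp add: n_def norm_sgn)
    then have "norm ((coef i * (\<phi> i - n i \<bullet> g)) *\<^sub>R n i) \<le> coef i * \<bar>\<phi> i - n i \<bullet> g\<bar> * 1"
      using coef_nonneg[of i] unfolding norm_scaleR abs_mult by (intro mult_mono) auto
    also have "\<dots> \<le> coef i * \<epsilon>"
      using \<phi>[OF \<open>i \<in> active\<close>] coef_nonneg[of i] by (simp add: n_def mult_left_mono)
    finally show "norm ((coef i * (\<phi> i - n i \<bullet> g)) *\<^sub>R n i) \<le> coef i * \<epsilon>" .
  qed
  also have "\<dots> = discrete_mass * \<epsilon>" by (simp add: discrete_mass_def sum_distrib_right)
  finally have R: "norm R / discrete_mass \<le> \<epsilon>" using D_pos by (simp add: divide_le_eq mult.commute)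
  have "g - 2 *\<^sub>R ((\<Sum>i\<in>active. (coef i * \<phi> i) *\<^sub>R n i) /\<^sub>R discrete_mass) = g - (mirror_sum g + discrete_mass *\<^sub>R g + 2 *\<^sub>R R) /\<^sub>R discrete_mass"
    by (simp add: split[symmetric])
  also have "\<dots> = - (mirror_sum g /\<^sub>R discrete_mass) - 2 *\<^sub>R (R /\<^sub>R discrete_mass)"
    using D_pos by (simp add: scaleR_add_right)
  also have "norm \<dots> \<le> norm (mirror_sum g /\<^sub>R discrete_mass) + norm (2 *\<^sub>R (R /\<^sub>R discrete_mass))"
    using norm_triangle_ineq4[of "- (mirror_sum g /\<^sub>R discrete_mass)" "2 *\<^sub>R (R /\<^sub>R discrete_mass)"] by (simp only: norm_minus_cancel)
  also have "\<dots> = norm (mirror_sum g) / discrete_mass + 2 * (norm R / discrete_mass)"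
    using D_pos by (simp add: divide_inverse mult.commute)
  finally show ?thesis using R by (simp add: n_def)
qed

end


section \<open>The error estimate\<close>

theorem theorem1p4:
  fixes \<Omega> :: "(real^2) set" and H h \<delta> lam L :: real and N k :: nat
    and a :: "nat \<Rightarrow> real^2" and w f :: "real^2 \<Rightarrow> real"
  assumes "open \<Omega>" and "connected \<Omega>" and "\<Omega> \<noteq> {}" and "bounded \<Omega>" and "H > 0"
    and "\<forall>i\<in>{1..N}. a i \<in> nbhd \<Omega> H" and "inj_on a {1..N}"
    and "r_sigma \<Omega> H N a < H"
    and "r_sigma \<Omega> H N a < h" and "h < H"
    and "k \<in> {1..N}" and "a k \<in> voronoi \<Omega> H N a k \<inter> \<Omega>"
    and "\<delta> > 0" and "ball (a k) \<delta> \<subseteq> voronoi \<Omega> H N a k \<inter> \<Omega>"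
    and "\<forall>x\<in>ball (a k) \<delta>. ball x (h + r_sigma \<Omega> H N a) \<subseteq> nbhd \<Omega> H"
    and "weight_function \<Omega> H N a k h \<delta> L w"
    and "0 < lam" and "lam < 1" and "neighbours N a k (a k) (lam * h) \<noteq> {}"
    and "C_closure 2 (nbhd \<Omega> H) f"
  shows "let r = r_sigma \<Omega> H N a;
             \<sigma> = voronoi \<Omega> H N a k;
             v = (\<lambda>y. w (a k - y));
             c1 = L1_norm_on (\<sigma> - ball (a k) \<delta>) v / L1_norm_on (ball (a k) h - ball (a k) \<delta>) v;
             c2 = pi * L * r * h\<^sup>2 / L1_norm_on (ball (a k) h - \<sigma>) v;
             c3 = L1_norm_on (ball (a k) (lam * h + r) - \<sigma>) v / L1_norm_on (ball (a k) h - \<sigma>) v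
         in norm (gradient f (a k) - discrete_gradient \<Omega> H N a k h \<delta> w f)
              \<le> 4 * h * C_norm 2 (nbhd \<Omega> H) f
                + (8 * r / (lam * h) + 4 * c1 + 4 * c2 + 8 * c3) * C_norm 1 (nbhd \<Omega> H) f"
proof -
  define X where "X = a k"
  define U where "U = nbhd \<Omega> H"
  define r where "r = r_sigma \<Omega> H N a"
  define \<sigma> where "\<sigma> = voronoi \<Omega> H N a"
  define v where "v y = w (X - y)" for y
  define v0 where "v0 y = (if y \<in> annulus h \<delta> X then v y else 0)" for y
  define g where "g = gradient f X"
  have shift: "X - y \<in> annulus h \<delta> 0 \<longleftrightarrow> y \<in> annulus h \<delta> X" for y
    by (simp add: annulus_def norm_minus_commute)
  have kN: "k \<in> {1..N}" by fact
  have radius: "norm (y - a i) \<le> r" if "i \<in> {1..N}" "y \<in> \<sigma> i" for i y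
    using voronoi_radius[OF \<open>bounded \<Omega>\<close> that(1)] that(2) by (simp add: \<sigma>_def r_def)
  have ballk: "ball X \<delta> \<subseteq> \<sigma> k" using assms(14) by (simp add: X_def \<sigma>_def)
  have Xk: "X \<in> \<sigma> k" using ballk \<open>\<delta> > 0\<close> by (meson centre_in_ball subsetD)
  have r0: "0 \<le> r" using radius[OF kN Xk] by (simp add: X_def)
  have h0: "0 < h" using r0 assms(9) by (simp add: r_def)
  have ballU: "ball X h \<subseteq> U"
  proof -
    have "ball X (h + r) \<subseteq> U"
      using assms(15) \<open>\<delta> > 0\<close> by (simp add: X_def U_def r_def)
    moreover have "ball X h \<subseteq> ball X (h + r)" using r0 by (intro subset_ball) simp
    ultimately show ?thesis by blast
  qed
  have dist_ge: "2 * \<delta> \<le> norm (X - a i)" if "i \<in> {1..N}" "i \<noteq> k" for i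
    using generator_distance_ge[of a k \<delta> \<Omega> H N i] ballk that by (simp add: X_def \<sigma>_def)
  \<comment> \<open>The particle within \<open>\<lambda> h\<close> makes the hole of the annulus small, so that the averaging region of
    \<open>mass_shell_le\<close> lies in the annulus.\<close>
  have \<delta>h: "2 * \<delta> < h"
  proof -
    obtain i where i: "i \<in> neighbours N a k (a k) (lam * h)" using assms(19) by blast
    then have "2 * \<delta> \<le> norm (X - a i)" "norm (X - a i) < lam * h"
      using dist_ge[of i] by (auto simp: neighbours_def X_def)
    moreover have "lam * h < h" using \<open>lam < 1\<close> h0 by simp
    ultimately show ?thesis by linarith
  qed

  note W = assms(16)[unfolded weight_function_def]
  have wcont: "continuous_on (annulus h \<delta> 0) w"
    using W continuous_on_subset closure_subset by blast
  have wnonneg: "0 \<le> w z" if "z \<in> annulus h \<delta> 0" for z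
    by (rule AE_nonneg_imp_nonneg[OF open_annulus wcont _ that]) (use W in auto)
  have wradial: "w z = w z'" if "z \<in> annulus h \<delta> 0" "norm z = norm z'" for z z'
  proof -
    obtain wh where "AE z in lebesgue. z \<in> annulus h \<delta> 0 \<longrightarrow> w z = wh (norm z)"
      using W by blast
    from AE_radial_imp_radial[OF wcont this that] show ?thesis .
  qed

  interpret particle_quadrature X a \<sigma> "{1..N}" k r h \<delta> L lam v0
  proof
    show "\<sigma> i \<in> sets lebesgue" for i
      unfolding \<sigma>_def using open_voronoi by (intro sets_completionI_sets) simp
    show "i = j" if "i \<in> {1..N}" "j \<in> {1..N}" "y \<in> \<sigma> i" "y \<in> \<sigma> j" for i j y
      using voronoi_disjoint[of i N j y \<Omega> H a] that by (simp add: \<sigma>_def)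
    have AU: "annulus h \<delta> X \<subseteq> nbhd \<Omega> H"
      using ballU \<open>\<delta> > 0\<close> by (auto simp: annulus_conv_ball U_def)
    show "AE y in lebesgue. y \<in> annulus h \<delta> X \<longrightarrow> (\<exists>i\<in>{1..N}. y \<in> \<sigma> i)"
      using voronoi_cover[OF assms(7) kN, of \<Omega> H] AU unfolding \<sigma>_def
      by (auto elim!: eventually_mono)
    show "\<delta> < norm (X - a i)" if "i \<in> {1..N}" "i \<noteq> k" for i
      using dist_ge[OF that] \<open>\<delta> > 0\<close> by linarith
    show "0 \<le> v0 y" for y using wnonneg[of "X - y"] by (simp add: v0_def v_def shift)
    show "\<bar>v0 y - v0 z\<bar> \<le> L * norm (y - z)" if "y \<in> annulus h \<delta> X" "z \<in> annulus h \<delta> X" for y z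
    proof -
      have "\<bar>w (X - y) - w (X - z)\<bar> \<le> L * norm ((X - y) - (X - z))"
        using W shift that by blast
      then show ?thesis using that by (simp add: v0_def v_def norm_minus_commute)
    qed
    show "v0 y = v0 z" if "y \<in> annulus h \<delta> X" "z \<in> annulus h \<delta> X" "norm (y - X) = norm (z - X)" for y z
      using wradial[of "X - y" "X - z"] shift[of y] that by (simp add: v0_def v_def norm_minus_commute)
  qed (use radius r0 \<open>\<delta> > 0\<close> \<delta>h W \<open>0 < lam\<close> \<open>lam < 1\<close> kN in \<open>auto simp: v0_def\<close>)

  have AEw: "AE z in lebesgue. w z = (if z \<in> annulus h \<delta> 0 then w z else 0)"
  proof -
    have spheres: "AE z in lebesgue. z \<notin> sphere 0 h \<union> sphere 0 \<delta>"
      by (intro AE_not_in) (simp flip: negligible_iff_null_sets add: negligible_sphere)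
    have "closure (annulus h \<delta> 0) \<subseteq> {z. \<delta> \<le> norm z \<and> norm z \<le> h}"
      by (rule closure_minimal) (auto simp: annulus_def intro!: closed_Collect_conj closed_Collect_le continuous_intros)
    then have closure: "z \<notin> closure (annulus h \<delta> 0)"
      if "z \<notin> annulus h \<delta> 0" "z \<notin> sphere 0 h \<union> sphere 0 \<delta>" for z
      using that by (auto simp: annulus_def)
    have "AE z in lebesgue. z \<notin> closure (annulus h \<delta> 0) \<longrightarrow> w z = 0" using W by blast
    then show ?thesis
      using spheres by eventually_elim (use closure in auto)
  qed
  have AEv: "AE y in lebesgue. v y = v0 y"
    using AE_lebesgue_compose[OF AEw, of "\<lambda>z. X - z" "\<lambda>y. X - y"]
    by (auto simp: v_def v0_def shift intro!: derivative_intros)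
  have v_meas: "v \<in> borel_measurable lebesgue"
    by (rule borel_measurable_AE[OF v_lebesgue]) (use AEv in \<open>auto elim: eventually_mono\<close>)
  have set_int: "(LINT y:B|lebesgue. v y) = mass B" and L1: "L1_norm_on B v = mass B"
    if [measurable]: "B \<in> sets lebesgue" for B
  proof -
    note [measurable] = v_meas
    show "(LINT y:B|lebesgue. v y) = mass B"
      unfolding set_lebesgue_integral_def mass_def
      by (rule integral_cong_AE) (use AEv in \<open>auto elim: eventually_mono\<close>)
    show "L1_norm_on B v = mass B"
      unfolding L1_norm_on_def set_lebesgue_integral_def mass_def
      by (rule integral_cong_AE) (use AEv v_nonneg in \<open>auto elim!: eventually_mono\<close>)
  qed
  have \<sigma>_sets [measurable]: "\<sigma> i \<in> sets lebesgue" for i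
    unfolding \<sigma>_def using open_voronoi by (intro sets_completionI_sets) simp
  have neighbours_eq: "neighbours N a k (a k) h = active"
    unfolding active_def neighbours_def X_def[symmetric] by auto
  have weight: "cell_vol \<Omega> H N a h \<delta> i (a k) * w (a k - a i) = coef i" if "i \<in> active" for i
    using generator_in_annulus[OF that]
    by (simp add: cell_vol_def coef_def X_def[symmetric] \<sigma>_def[symmetric] v0_def v_def set_lebesgue_integral_def)
  obtain C0 where C0: "C0 > 0"
    "(\<Sum>i\<in>neighbours N a k X h. LINT y:voronoi \<Omega> H N a i|lebesgue. w (X - y)) \<ge> C0"
    "(\<Sum>j\<in>neighbours N a k X h. cell_vol \<Omega> H N a h \<delta> j X * w (X - a j)) \<ge> C0"
    using W \<open>\<delta> > 0\<close> unfolding X_def by (meson centre_in_ball)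
  have D_pos: "0 < discrete_mass"
    using C0(1,3) weight neighbours_eq unfolding discrete_mass_def X_def[symmetric] by simp
  \<comment> \<open>The lower bound on the cell integrals over the active particles keeps the denominators of \<open>c\<^sub>2\<close>
    and \<open>c\<^sub>3\<close> from vanishing.\<close>
  have P_pos: "0 < mass (- \<sigma> k)"
  proof -
    have "C0 \<le> (\<Sum>i\<in>active. mass (\<sigma> i))"
      using C0(2) neighbours_eq by (simp add: set_int \<sigma>_def[symmetric] X_def[symmetric] v_def[symmetric])
    also have "\<dots> = (LINT y|lebesgue. (\<Sum>i\<in>active. indicator (\<sigma> i) y * v0 y))"
      unfolding mass_def by (rule Bochner_Integration.integral_sum[symmetric]) (rule integrable_mass[OF \<sigma>_sets])
    also have "\<dots> \<le> mass (- \<sigma> k)"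
      unfolding mass_def
    proof (rule integral_mono)
      show "integrable lebesgue (\<lambda>y. \<Sum>i\<in>active. indicator (\<sigma> i) y * v0 y)"
        by (intro Bochner_Integration.integrable_sum integrable_mass \<sigma>_sets)
      show "integrable lebesgue (\<lambda>y. indicator (- \<sigma> k) y * v0 y)"
        by (intro integrable_mass) (simp add: Compl_in_sets_lebesgue)
      fix y
      have "(\<Sum>i\<in>active. indicator (\<sigma> i) y :: real) \<le> indicator (- \<sigma> k) y"
      proof (cases "\<exists>i\<in>active. y \<in> \<sigma> i")
        case True
        then obtain i where i: "i \<in> active" "y \<in> \<sigma> i" by blast
        have ji: "y \<in> \<sigma> j \<longleftrightarrow> j = i" if "j \<in> {1..N}" for j
          using cell_disjoint[OF that _ _ i(2)] i active_subset by blast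
        have "i \<noteq> k" using i(1) unfolding active_def by blast
        then have "y \<notin> \<sigma> k" using ji[OF kN] by blast
        moreover have "indicator (\<sigma> j) y = (if j = i then 1 else 0 :: real)" if "j \<in> active" for j
          using ji[OF subsetD[OF active_subset that]] by (simp add: indicator_def)
        ultimately show ?thesis using finite_active i by simp
      next
        case False
        then show ?thesis by (simp add: sum.neutral)
      qed
      then show "(\<Sum>i\<in>active. indicator (\<sigma> i) y * v0 y) \<le> indicator (- \<sigma> k) y * v0 y"
        unfolding sum_distrib_right[symmetric] using v_nonneg by (rule mult_right_mono)
    qed
    finally show ?thesis using C0(1) by linarith
  qed

  define M1 M2 where "M1 = C_norm 1 U f" and "M2 = C_norm 2 U f"
  have bU: "bounded U" unfolding U_def by (rule bounded_nbhd) fact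
  have XU: "X \<in> U" using ballU h0 by auto
  have C: "C_closure 2 U f" unfolding U_def by fact
  have D2: "\<bar>multi_deriv \<alpha> f z\<bar> \<le> M2" if "fst \<alpha> + snd \<alpha> = 2" "z \<in> U" for \<alpha> z
    unfolding M2_def using multi_deriv_le_C_norm[OF C bU that(1) _ that(2)] by simp
  have D1: "\<bar>partial_deriv i f X\<bar> \<le> M1" for i
    using multi_deriv_le_C_norm[OF C bU, of "(1,0)" 1 X] multi_deriv_le_C_norm[OF C bU, of "(0,1)" 1 X]
      XU exhaust_2[of i] by (auto simp: M1_def multi_deriv_def)
  have M0: "0 \<le> M1" "0 \<le> M2" using D1[of 1] D2[of "(2,0)" X] XU by auto
  have ng: "norm g \<le> sqrt 2 * M1" unfolding g_def by (rule norm_gradient_le) (rule D1)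
  define \<phi> where "\<phi> i = (f X - f (a i)) / norm (X - a i)" for i
  have \<phi>: "\<bar>\<phi> i - sgn (X - a i) \<bullet> g\<bar> \<le> 2 * M2 * h" if "i \<in> active" for i
  proof -
    define d where "d = norm (X - a i)"
    have d: "0 < d" "d < h"
      using generator_in_annulus[OF that] \<open>\<delta> > 0\<close> by (auto simp: d_def annulus_def norm_minus_commute)
    have "\<bar>f (X + (a i - X)) - f X - gradient f X \<bullet> (a i - X)\<bar> \<le> 2 * M2 * (norm (a i - X))\<^sup>2"
      by (rule gradient_remainder[OF _ ballU _ D2])
        (use C d in \<open>auto simp: C_closure_def d_def norm_minus_commute\<close>)
    then have "\<bar>f X - f (a i) - (X - a i) \<bullet> g\<bar> \<le> 2 * M2 * d\<^sup>2"
      by (simp add: g_def d_def norm_minus_commute inner_commute inner_diff_left abs_minus_commute algebra_simps)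
    moreover have "\<phi> i - sgn (X - a i) \<bullet> g = (f X - f (a i) - (X - a i) \<bullet> g) / d"
      by (simp add: \<phi>_def d_def sgn_div_norm divide_inverse right_diff_distrib mult.commute)
    ultimately have "\<bar>\<phi> i - sgn (X - a i) \<bullet> g\<bar> \<le> 2 * M2 * d"
      using d by (simp add: divide_le_eq power2_eq_square mult.assoc)
    also have "\<dots> \<le> 2 * M2 * h" using d M0 by (intro mult_left_mono) auto
    finally show ?thesis .
  qed
  have dg: "discrete_gradient \<Omega> H N a k h \<delta> w f
      = 2 *\<^sub>R ((\<Sum>i\<in>active. (coef i * \<phi> i) *\<^sub>R sgn (X - a i)) /\<^sub>R discrete_mass)"
  proof -
    have "(\<Sum>i\<in>active. (cell_vol \<Omega> H N a h \<delta> i (a k) * ((f (a k) - f (a i)) / norm (a k - a i)) *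
        w (a k - a i)) *\<^sub>R ((a k - a i) /\<^sub>R norm (a k - a i)))
      = (\<Sum>i\<in>active. (coef i * \<phi> i) *\<^sub>R sgn (X - a i))"
      unfolding X_def[symmetric]
      by (intro sum.cong refl) (simp add: weight[unfolded X_def[symmetric], symmetric] \<phi>_def sgn_div_norm)
    moreover have "(\<Sum>i\<in>active. cell_vol \<Omega> H N a h \<delta> i (a k) * w (a k - a i)) = discrete_mass"
      unfolding discrete_mass_def by (intro sum.cong refl weight)
    ultimately show ?thesis unfolding discrete_gradient_def neighbours_eq by simp
  qed
  define B where "B = 8 * r / (lam * h) + 4 * (mass (\<sigma> k) / mass UNIV)
    + 4 * (pi * L * r * h\<^sup>2 / mass (- \<sigma> k))
    + 8 * (mass (ball X (lam * h + r) - \<sigma> k) / mass (- \<sigma> k))"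
  have B0: "0 \<le> B"
    using r0 h0 \<open>0 < lam\<close> L_nonneg mass_nonneg by (simp add: B_def)
  have "norm (g - discrete_gradient \<Omega> H N a k h \<delta> w f) \<le> 2 * (2 * M2 * h) + norm (mirror_sum g) / discrete_mass"
    unfolding dg by (rule gradient_error_le[OF D_pos \<phi>])
  also have "norm (mirror_sum g) / discrete_mass \<le> norm g * (7 / 10 * B)"
    unfolding B_def by (rule relative_mirror_sum_le[OF D_pos P_pos])
  also have "norm g * (7 / 10 * B) \<le> (10 / 7 * M1) * (7 / 10 * B)"
  proof (rule mult_right_mono)
    have "sqrt 2 \<le> 10 / 7" by (rule real_le_lsqrt) (simp_all add: power2_eq_square)
    then have "sqrt 2 * M1 \<le> 10 / 7 * M1" using M0(1) by (rule mult_right_mono)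
    then show "norm g \<le> 10 / 7 * M1" using ng by linarith
  qed (use B0 in simp)
  finally have main: "norm (g - discrete_gradient \<Omega> H N a k h \<delta> w f) \<le> 4 * h * M2 + B * M1"
    by (simp add: algebra_simps)
  have m1: "L1_norm_on (\<sigma> k - ball X \<delta>) v = mass (\<sigma> k)"
    by (subst L1) (auto intro!: mass_cong simp: annulus_def dist_norm norm_minus_commute)
  have m2: "L1_norm_on (ball X h - ball X \<delta>) v = mass UNIV"
    by (subst L1) (auto intro!: mass_cong simp: annulus_def dist_norm norm_minus_commute)
  have m3: "L1_norm_on (ball X h - \<sigma> k) v = mass (- \<sigma> k)"
    by (subst L1) (auto intro!: mass_cong simp: annulus_def dist_norm norm_minus_commute)
  have m4: "L1_norm_on (ball X (lam * h + r) - \<sigma> k) v = mass (ball X (lam * h + r) - \<sigma> k)"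
    by (subst L1) auto
  have veq: "(\<lambda>y. w (X - y)) = v" by (rule ext) (simp add: v_def)
  show ?thesis
    using main unfolding Let_def X_def[symmetric] veq \<sigma>_def[symmetric] r_def[symmetric] U_def[symmetric]
      m1 m2 m3 m4 B_def g_def M1_def M2_def .
qed

end
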